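(* Consider the model $dy_t=S(t)\,dt+dw_t$, where $(w_t)_{t\ge0}$ is a standard Brownian motion. The improved model selection procedure $S^*_{m^*}$, constructed from the estimators $S^*_m=\widehat S_m+\Psi_m(\widehat S_m)$, $m\in\mathcal M$, with $\lambda^*=2$, satisfies $$\mathbf{E}_S\|S^*_{m^*}-S\|^2\le\inf_{m\in\mathcal M}u^*_m(S)+\frac{2\tau_0}{n},$$ where $$u^*_m(S)=3\,\mathbf{E}_S\|S^*_m-S\|^2+32\,z_*\frac{d_ml_m}{n},\qquad\tau_0=\frac{16\,l^*z_*}{z_*-1}.$$
   Context: $S$ is an unknown $1$-periodic function, square integrable on $[0,1]$. The process $(y_t)_{0\le t\le n}$ is observed, with $n\ge1$ fixed. $\mathbf{E}_S$ denotes expectation with respect to the distribution of the observed process given $S$. $\mathcal X$ is the Hilbert space of square integrable $1$-periodic functions on $\mathbb R$ with $(x,y)=\int_0^1x(t)y(t)\,dt$ and $\|x\|^2=(x,x)$. $(\phi_j)_{j\ge1}$ is an orthonormal system in $\mathcal X$. $\mathcal M$ is a finite set of finite subsets of $\mathbb N=\{1,2,\ldots\}$. For $m\in\mathcal M$, $\mathcal D_m=\{\sum_{j\in m}\lambda_j\phi_j:\lambda_j\in\mathbb R\}$ and $d_m$ is the number of elements of $m$. The least squares estimators are $\widehat S_m=\sum_{j\in m}\widehat\alpha_j\phi_j$ with $\widehat\alpha_j=\frac1n\int_0^n\phi_j(t)\,dy_t$. For each $m$ put $\widehat\alpha=(\widehat\alpha_j)_{j\in m}\in\mathbb R^{d_m}$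 and let $v_j:\mathbb R^{d_m}\to\mathbb R$, $j\in m$, be (measurable) functions with $\mathbf{E}_Sv_j^2(\widehat\alpha)<\infty$ (they may depend on $m$). Put $\Psi_m(x)(t)=\sum_{j\in m}v_j(x)\phi_j(t)$ for $x\in\mathbb R^{d_m}$; $\Psi_m(\widehat S_m)$ means $\Psi_m(\widehat\alpha)$. (The principal example in the paper, for $d_m>2$, is $v(u)=-\frac{(d_m-2)u}{n\|u\|^2}$.) The weights $(l_m)_{m\in\mathcal M}$ satisfy $l_m\ge1$, and $l^*=\sum_{m\in\mathcal M}e^{-l_md_m}$. The number $z_*$ is the maximal root of $\ln z=z-2$ ($z_*\approx3.1462$). The penalty is $P_n(m)=\rho\,\frac{l_md_m}{n}$ with $\rho=4\lambda^*\frac{z_*^2}{z_*-1}$; here $\lambda^*=2$. The contrast is $\gamma_n(x)=\|x\|^2-\frac2n\int_0^nx(t)\,dy_t$ (extended by linearity of the integral to finite combinations of the $\phi_j$ with random coefficients). The selected index is $m^*=\operatorname{argmin}_{m\in\mathcal M}\{\gamma_n(S^*_m)+P_n(m)\}$. *)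

theory Defs
  imports "HOL-Probability.Probability"
begin

definition periodic_L2 :: "(real \<Rightarrow> real) set" where
  "periodic_L2 = {x. x \<in> borel_measurable lebesgue \<and> (\<forall>t. x (t + 1) = x t) \<and>
     set_integrable lebesgue {0..1} (\<lambda>t. (x t)\<^sup>2)}"

definition ip :: "(real \<Rightarrow> real) \<Rightarrow> (real \<Rightarrow> real) \<Rightarrow> real" where
  "ip x y = (LINT t:{0..1}|lebesgue. x t * y t)"

definition sqnorm :: "(real \<Rightarrow> real) \<Rightarrow> real" where
  "sqnorm x = ip x x"

definition orthonormal_system :: "(nat \<Rightarrow> real \<Rightarrow> real) \<Rightarrow> bool" where
  "orthonormal_system \<phi> \<longleftrightarrow> (\<forall>j\<ge>1. \<phi> j \<in> periodic_L2) \<and>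
     (\<forall>i\<ge>1. \<forall>j\<ge>1. ip (\<phi> i) (\<phi> j) = (if i = j then 1 else 0))"

definition standard_brownian_motion :: "'a measure \<Rightarrow> (real \<Rightarrow> 'a \<Rightarrow> real) \<Rightarrow> bool" where
  "standard_brownian_motion M w \<longleftrightarrow>
     prob_space M \<and>
     (\<forall>t\<ge>0. w t \<in> borel_measurable M) \<and>
     (AE \<omega> in M. w 0 \<omega> = 0) \<and>
     (\<forall>(t :: nat \<Rightarrow> real) k. 0 \<le> t 0 \<and> mono t \<longrightarrow>
        prob_space.indep_vars M (\<lambda>_. borel) (\<lambda>i \<omega>. w (t (Suc i)) \<omega> - w (t i) \<omega>) {..<k}) \<and>
     (\<forall>s t. 0 \<le> s \<and> s < t \<longrightarrow>
        distributed M lborel (\<lambda>\<omega>. w t \<omega> - w s \<omega>) (normal_density 0 (sqrt (t - s)))) \<and>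
     (AE \<omega> in M. continuous_on {0..} (\<lambda>t. w t \<omega>))"

text \<open>The integrated form of \<open>dy\<^sub>t = S(t) dt + dw\<^sub>t\<close> on \<open>[0,T]\<close>; the initial value \<open>y\<^sub>0\<close> is
  left arbitrary, since only increments of \<open>y\<close> are used below.\<close>

definition signal_in_noise ::
  "'a measure \<Rightarrow> real \<Rightarrow> (real \<Rightarrow> real) \<Rightarrow> (real \<Rightarrow> 'a \<Rightarrow> real) \<Rightarrow> (real \<Rightarrow> 'a \<Rightarrow> real) \<Rightarrow> bool" where
  "signal_in_noise M T S w y \<longleftrightarrow>
     (\<forall>t\<in>{0..T}. y t \<in> borel_measurable M) \<and>
     (AE \<omega> in M. \<forall>t\<in>{0..T}. y t \<omega> = y 0 \<omega> + (LINT s:{0..t}|lebesgue. S s) + w t \<omega>)"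

text \<open>A list of triples \<open>(a, b, c)\<close> encodes the step function that is the sum of the functions
  \<open>c\<close> times the indicator of \<open>(a, b]\<close>.\<close>

definition step_fun :: "(real \<times> real \<times> real) list \<Rightarrow> real \<Rightarrow> real" where
  "step_fun xs t = (\<Sum>(a, b, c)\<leftarrow>xs. c * indicator {a<..b} t)"

definition step_integral ::
  "(real \<Rightarrow> 'a \<Rightarrow> real) \<Rightarrow> (real \<times> real \<times> real) list \<Rightarrow> 'a \<Rightarrow> real" where
  "step_integral y xs \<omega> = (\<Sum>(a, b, c)\<leftarrow>xs. c * (y b \<omega> - y a \<omega>))"

text \<open>\<open>I\<close> is a version of the stochastic integral of the deterministic function \<open>f\<close> with
  respect to \<open>y\<close> over \<open>[0,T]\<close>: the mean-square limit of the integrals of step functions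
  converging to \<open>f\<close> in \<open>L\<^sup>2[0,T]\<close>.  For \<open>y\<close> as in \<^const>\<open>signal_in_noise\<close> with a Brownian motion
  \<open>w\<close> and \<open>S\<close> square integrable on \<open>[0,T]\<close>, the map from step functions to their integrals is
  bounded from \<open>L\<^sup>2[0,T]\<close> to \<open>L\<^sup>2(M)\<close>, so that for square integrable \<open>f\<close> such an \<open>I\<close> exists, is
  unique almost surely, and equals the integral of \<open>f S\<close> over \<open>[0,T]\<close> plus the Wiener integral
  of \<open>f\<close> with respect to \<open>w\<close>.\<close>

definition has_stochastic_integral ::
  "'a measure \<Rightarrow> (real \<Rightarrow> 'a \<Rightarrow> real) \<Rightarrow> real \<Rightarrow> (real \<Rightarrow> real) \<Rightarrow> ('a \<Rightarrow> real) \<Rightarrow> bool" where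
  "has_stochastic_integral M y T f I \<longleftrightarrow>
     I \<in> borel_measurable M \<and>
     (\<exists>xs :: nat \<Rightarrow> (real \<times> real \<times> real) list.
        (\<forall>k. \<forall>(a, b, c)\<in>set (xs k). 0 \<le> a \<and> a \<le> b \<and> b \<le> T) \<and>
        (\<lambda>k. \<integral>\<^sup>+t\<in>{0..T}. ennreal ((f t - step_fun (xs k) t)\<^sup>2) \<partial>lebesgue) \<longlonglongrightarrow> 0 \<and>
        (\<lambda>k. \<integral>\<^sup>+\<omega>. ennreal ((I \<omega> - step_integral y (xs k) \<omega>)\<^sup>2) \<partial>M) \<longlonglongrightarrow> 0)"

text \<open>In the following, \<open>J j\<close> stands for (a version of) the stochastic integral of \<open>\<phi> j\<close> with
  respect to the observed process over \<open>[0,n]\<close>, and a point of \<open>\<real>\<^bsup>d\<^esup>\<close> with coordinates indexed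
  by the \<open>d\<close> elements of \<open>m\<close> is an element of the product space over \<open>m\<close>.\<close>

definition alpha_hat :: "nat \<Rightarrow> (nat \<Rightarrow> 'a \<Rightarrow> real) \<Rightarrow> nat \<Rightarrow> 'a \<Rightarrow> real" where
  "alpha_hat n J j \<omega> = J j \<omega> / real n"

definition alpha_vec :: "nat \<Rightarrow> (nat \<Rightarrow> 'a \<Rightarrow> real) \<Rightarrow> nat set \<Rightarrow> 'a \<Rightarrow> nat \<Rightarrow> real" where
  "alpha_vec n J m \<omega> = (\<lambda>j\<in>m. alpha_hat n J j \<omega>)"

definition lin_comb :: "(nat \<Rightarrow> real \<Rightarrow> real) \<Rightarrow> nat set \<Rightarrow> (nat \<Rightarrow> real) \<Rightarrow> real \<Rightarrow> real" where
  "lin_comb \<phi> m c t = (\<Sum>j\<in>m. c j * \<phi> j t)"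

definition lse ::
  "(nat \<Rightarrow> real \<Rightarrow> real) \<Rightarrow> nat \<Rightarrow> (nat \<Rightarrow> 'a \<Rightarrow> real) \<Rightarrow> nat set \<Rightarrow> 'a \<Rightarrow> real \<Rightarrow> real" where
  "lse \<phi> n J m \<omega> = lin_comb \<phi> m (\<lambda>j. alpha_hat n J j \<omega>)"

definition Psi ::
  "(nat \<Rightarrow> real \<Rightarrow> real) \<Rightarrow> (nat set \<Rightarrow> nat \<Rightarrow> (nat \<Rightarrow> real) \<Rightarrow> real) \<Rightarrow> nat set \<Rightarrow>
   (nat \<Rightarrow> real) \<Rightarrow> real \<Rightarrow> real" where
  "Psi \<phi> v m x = lin_comb \<phi> m (\<lambda>j. v m j x)"

definition improved_estimator ::
  "(nat \<Rightarrow> real \<Rightarrow> real) \<Rightarrow> nat \<Rightarrow> (nat \<Rightarrow> 'a \<Rightarrow> real) \<Rightarrow>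
   (nat set \<Rightarrow> nat \<Rightarrow> (nat \<Rightarrow> real) \<Rightarrow> real) \<Rightarrow> nat set \<Rightarrow> 'a \<Rightarrow> real \<Rightarrow> real" where
  "improved_estimator \<phi> n J v m \<omega> t = lse \<phi> n J m \<omega> t + Psi \<phi> v m (alpha_vec n J m \<omega>) t"

definition improved_coeff ::
  "nat \<Rightarrow> (nat \<Rightarrow> 'a \<Rightarrow> real) \<Rightarrow> (nat set \<Rightarrow> nat \<Rightarrow> (nat \<Rightarrow> real) \<Rightarrow> real) \<Rightarrow>
   nat set \<Rightarrow> 'a \<Rightarrow> nat \<Rightarrow> real" where
  "improved_coeff n J v m \<omega> j = alpha_hat n J j \<omega> + v m j (alpha_vec n J m \<omega>)"

text \<open>The contrast of the combination of the \<open>\<phi> j\<close> with coefficients \<open>c\<close>: its integral with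
  respect to the observed process is defined by linearity, so that \<open>c\<close> may depend on \<open>\<omega>\<close>.\<close>

definition contrast ::
  "(nat \<Rightarrow> real \<Rightarrow> real) \<Rightarrow> nat \<Rightarrow> (nat \<Rightarrow> 'a \<Rightarrow> real) \<Rightarrow> nat set \<Rightarrow> (nat \<Rightarrow> real) \<Rightarrow> 'a \<Rightarrow> real" where
  "contrast \<phi> n J m c \<omega> = sqnorm (lin_comb \<phi> m c) - 2 / real n * (\<Sum>j\<in>m. c j * J j \<omega>)"

definition z_star :: real where
  "z_star = (GREATEST z. 0 < z \<and> ln z = z - 2)"

definition rho :: "real \<Rightarrow> real" where
  "rho lam = 4 * lam * (z_star\<^sup>2 / (z_star - 1))"

definition penalty :: "real \<Rightarrow> (nat set \<Rightarrow> real) \<Rightarrow> nat \<Rightarrow> nat set \<Rightarrow> real" where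
  "penalty lam l n m = rho lam * (l m * real (card m) / real n)"

definition l_star :: "nat set set \<Rightarrow> (nat set \<Rightarrow> real) \<Rightarrow> real" where
  "l_star \<M> l = (\<Sum>m\<in>\<M>. exp (- l m * real (card m)))"

definition tau0 :: "nat set set \<Rightarrow> (nat set \<Rightarrow> real) \<Rightarrow> real" where
  "tau0 \<M> l = 16 * l_star \<M> l * z_star / (z_star - 1)"

definition u_star ::
  "'a measure \<Rightarrow> (real \<Rightarrow> real) \<Rightarrow> (nat \<Rightarrow> real \<Rightarrow> real) \<Rightarrow> nat \<Rightarrow> (nat \<Rightarrow> 'a \<Rightarrow> real) \<Rightarrow>
   (nat set \<Rightarrow> nat \<Rightarrow> (nat \<Rightarrow> real) \<Rightarrow> real) \<Rightarrow> (nat set \<Rightarrow> real) \<Rightarrow> nat set \<Rightarrow> real" where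
  "u_star M S \<phi> n J v l m =
     3 * (LINT \<omega>|M. sqnorm (\<lambda>t. improved_estimator \<phi> n J v m \<omega> t - S t)) +
     32 * z_star * (real (card m) * l m / real n)"

end

theory Submission
  imports Defs
begin

text \<open>
  Comparing contrasts at \<open>m\<^sup>*\<close> and at a fixed \<open>m\<close>, the difference of the two losses is bounded by
  the difference of the penalties plus twice the noise functional at \<open>S\<^sup>*\<^bsub>m\<^sup>*\<^esub> - S\<^sup>*\<^bsub>m\<^esub>\<close>.  This element lies in the span
  of the \<open>\<phi>\<^sub>j\<close> with \<open>j \<in> m \<union> m\<^sup>*\<close>, so the inequality \<open>2ab \<le> a\<^sup>2/4 + 4b\<^sup>2\<close> absorbs its norm into the
  losses (whence the factor 3) and leaves \<open>8/n\<close> times the sum of the squares of the normalised noise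
  coordinates \<open>Z\<^sub>j\<close> over \<open>m\<close> and \<open>m\<^sup>*\<close>.  The sum over the random index \<open>m\<^sup>*\<close> is controlled by its
  penalty and a union bound: \<open>\<^bold>E exp (\<Sum>\<^bsub>j\<in>m\<^esub> Z\<^sub>j\<^sup>2 / 4) \<le> 2\<^bsup>d/2\<^esup>\<close> and \<open>x \<le> 4 exp (x/4)\<close>.  That
  exponential moment follows from the sub-Gaussian bound for the Wiener integrals of
  linear combinations of the \<open>\<phi>\<^sub>j\<close>.  Of \<open>z\<^sub>*\<close> only \<open>z\<^sub>* \<ge> 3\<close> is used.
\<close>

section \<open>Gaussian exponential integrals, Brownian increments and step integrals\<close>

text \<open>Completing the square: the factor \<open>exp (c * x)\<close> moves the mean of the
  density to \<open>c * \<sigma>\<^sup>2\<close> at the cost of a constant, and the moved density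
  has total mass 1.\<close>

lemma nn_integral_exp_normal_density:
  assumes "0 < \<sigma>"
  shows "(\<integral>\<^sup>+x. ennreal (normal_density 0 \<sigma> x) * ennreal (exp (c * x)) \<partial>lborel) = ennreal (exp (c\<^sup>2 * \<sigma>\<^sup>2 / 2))"
proof -
  have eq: "normal_density 0 \<sigma> x * exp (c * x) = exp (c\<^sup>2 * \<sigma>\<^sup>2 / 2) * normal_density (c * \<sigma>\<^sup>2) \<sigma> x" for x
  proof -
    have "- (x - 0)\<^sup>2 / (2 * \<sigma>\<^sup>2) + c * x = c\<^sup>2 * \<sigma>\<^sup>2 / 2 + - (x - c * \<sigma>\<^sup>2)\<^sup>2 / (2 * \<sigma>\<^sup>2)"
      using assms by (simp add: field_simps power2_eq_square)
    then show ?thesis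
      unfolding normal_density_def by (simp add: exp_add [symmetric] mult_ac)
  qed
  have "(\<integral>\<^sup>+x. ennreal (normal_density 0 \<sigma> x) * ennreal (exp (c * x)) \<partial>lborel)
      = (\<integral>\<^sup>+x. ennreal (exp (c\<^sup>2 * \<sigma>\<^sup>2 / 2)) * ennreal (normal_density (c * \<sigma>\<^sup>2) \<sigma> x) \<partial>lborel)"
    by (simp add: ennreal_mult' [symmetric] eq)
  also have "\<dots> = ennreal (exp (c\<^sup>2 * \<sigma>\<^sup>2 / 2)) * (\<integral>\<^sup>+x. ennreal (normal_density (c * \<sigma>\<^sup>2) \<sigma> x) \<partial>lborel)"
    by (rule nn_integral_cmult) auto
  also have "(\<integral>\<^sup>+x. ennreal (normal_density (c * \<sigma>\<^sup>2) \<sigma> x) \<partial>lborel) = 1"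
    using assms by (subst nn_integral_eq_integral) auto
  finally show ?thesis by simp
qed

text \<open>The factor \<open>exp (x\<^sup>2 / 4)\<close> halves the exponent of the standard normal
  density. What remains is a normal density of variance 2, up to the ratio \<open>sqrt 2\<close> of
  the normalising constants.\<close>

lemma nn_integral_exp_square_std_normal:
  "(\<integral>\<^sup>+x. ennreal (std_normal_density x) * ennreal (exp (x\<^sup>2 / 4)) \<partial>lborel) = ennreal (sqrt 2)"
proof -
  have eq: "std_normal_density x * exp (x\<^sup>2 / 4) = sqrt 2 * normal_density 0 (sqrt 2) x" for x
  proof -
    have "- (x - 0)\<^sup>2 / (2 * 1\<^sup>2) + x\<^sup>2 / 4 = - (x - 0)\<^sup>2 / (2 * (sqrt 2)\<^sup>2)"
      by simp
    moreover have "sqrt (2 * pi * (sqrt 2)\<^sup>2) = sqrt 2 * sqrt (2 * pi * 1\<^sup>2)"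
      by (simp add: real_sqrt_mult)
    ultimately show ?thesis
      unfolding normal_density_def by (simp add: exp_add [symmetric] mult.assoc)
  qed
  have "(\<integral>\<^sup>+x. ennreal (std_normal_density x) * ennreal (exp (x\<^sup>2 / 4)) \<partial>lborel)
      = (\<integral>\<^sup>+x. ennreal (sqrt 2) * ennreal (normal_density 0 (sqrt 2) x) \<partial>lborel)"
    by (simp add: ennreal_mult' [symmetric] eq)
  also have "\<dots> = ennreal (sqrt 2) * (\<integral>\<^sup>+x. ennreal (normal_density 0 (sqrt 2) x) \<partial>lborel)"
    by (rule nn_integral_cmult) auto
  also have "(\<integral>\<^sup>+x. ennreal (normal_density 0 (sqrt 2) x) \<partial>lborel) = 1"
    by (subst nn_integral_eq_integral) auto
  finally show ?thesis by simp
qed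

text \<open>Independence factorises the exponential of the sum into Gaussian exponential moments of
  the single increments.\<close>

lemma (in prob_space) nn_integral_exp_brownian_increments:
  fixes t :: "nat \<Rightarrow> real"
  assumes w: "standard_brownian_motion M w" and t: "0 \<le> t 0" "mono t"
  shows "(\<integral>\<^sup>+\<omega>. ennreal (exp (\<Sum>i<K. c i * (w (t (Suc i)) \<omega> - w (t i) \<omega>))) \<partial>M)
    = ennreal (exp ((\<Sum>i<K. (c i)\<^sup>2 * (t (Suc i) - t i)) / 2))"
proof -
  let ?D = "\<lambda>i \<omega>. w (t (Suc i)) \<omega> - w (t i) \<omega>"
  have t0: "0 \<le> t i" for i
    using t monoD [OF t(2), of 0 i] by simp
  have meas [measurable]: "w (t i) \<in> borel_measurable M" for i
    using w t0 by (auto simp: standard_brownian_motion_def)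
  have indep: "indep_vars (\<lambda>_. borel) ?D {..<K}"
    using w t by (auto simp: standard_brownian_motion_def)
  have single: "(\<integral>\<^sup>+\<omega>. ennreal (exp (c i * ?D i \<omega>)) \<partial>M) = ennreal (exp ((c i)\<^sup>2 * (t (Suc i) - t i) / 2))" for i
  \<comment> \<open>Points of the sequence may coincide. The increment is then identically zero and
    has no density, but its exponential moment is still 1.\<close>
  proof (cases "t i = t (Suc i)")
    case True
    then show ?thesis by (simp add: emeasure_space_1)
  next
    case False
    with monoD [OF t(2), of i "Suc i"] have lt: "t i < t (Suc i)" by simp
    have "distributed M lborel (?D i) (normal_density 0 (sqrt (t (Suc i) - t i)))"
      using w lt t0 by (auto simp: standard_brownian_motion_def)
    then have "(\<integral>\<^sup>+\<omega>. ennreal (exp (c i * ?D i \<omega>)) \<partial>M)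
       = (\<integral>\<^sup>+x. ennreal (normal_density 0 (sqrt (t (Suc i) - t i)) x) * ennreal (exp (c i * x)) \<partial>lborel)"
      by (rule distributed_nn_integral [symmetric]) simp
    also have "\<dots> = ennreal (exp ((c i)\<^sup>2 * (t (Suc i) - t i) / 2))"
      using lt by (subst nn_integral_exp_normal_density) auto
    finally show ?thesis .
  qed
  have "(\<integral>\<^sup>+\<omega>. ennreal (exp (\<Sum>i<K. c i * ?D i \<omega>)) \<partial>M)
      = (\<integral>\<^sup>+\<omega>. (\<Prod>i<K. ennreal (exp (c i * ?D i \<omega>))) \<partial>M)"
    by (simp add: exp_sum prod_ennreal)
  also have "\<dots> = (\<Prod>i<K. \<integral>\<^sup>+\<omega>. ennreal (exp (c i * ?D i \<omega>)) \<partial>M)"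
    by (intro indep_vars_nn_integral indep_vars_compose2 [OF indep]) auto
  also have "\<dots> = ennreal (exp ((\<Sum>i<K. (c i)\<^sup>2 * (t (Suc i) - t i)) / 2))"
    by (simp add: single prod_ennreal exp_sum [symmetric] sum_divide_distrib)
  finally show ?thesis .
qed

text \<open>Stated for all \<open>g\<close> at once so that the same coefficients serve for the paths of a process and,
  with \<open>g s\<close> the indicator of \<open>{..s}\<close>, for the step function itself.\<close>

lemma step_common_partition:
  fixes t :: "nat \<Rightarrow> real"
  assumes "mono t"
    and "\<forall>(a, b, c)\<in>set xs. a \<le> b \<and> a \<in> t ` {..K} \<and> b \<in> t ` {..K}"
  shows "\<exists>d. \<forall>g::real \<Rightarrow> real.
    (\<Sum>(a, b, c)\<leftarrow>xs. c * (g b - g a)) = (\<Sum>i<K. d i * (g (t (Suc i)) - g (t i)))"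
  using assms(2)
proof (induction xs)
  case Nil
  show ?case by (rule exI [of _ "\<lambda>_. 0"]) simp
next
  case (Cons x xs)
  obtain a b c where x: "x = (a, b, c)" by (cases x) auto
  obtain d where d: "\<And>g::real \<Rightarrow> real.
      (\<Sum>(a, b, c)\<leftarrow>xs. c * (g b - g a)) = (\<Sum>i<K. d i * (g (t (Suc i)) - g (t i)))"
    using Cons by auto
  obtain p0 q0 where pq0: "p0 \<le> K" "q0 \<le> K" "a = t p0" "b = t q0"
    using Cons.prems x by auto
  have ab: "a \<le> b" using Cons.prems x by auto
  \<comment> \<open>Since \<open>t\<close> may repeat values, the indices found for \<open>a\<close>
    and \<open>b\<close> can come in the wrong order. In that case \<open>a = b\<close>, and one
    index serves for both.\<close>
  obtain p q where pq: "p \<le> q" "q \<le> K" "a = t p" "b = t q"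
  proof (cases "p0 \<le> q0")
    case True then show ?thesis using pq0 that by blast
  next
    case False
    then have "b \<le> a" using pq0 monoD [OF assms(1), of q0 p0] by simp
    then show ?thesis using ab pq0 that [of p0 p0] by auto
  qed
  \<comment> \<open>The coefficient \<open>c\<close> is spread over all cells between
    \<open>a\<close> and \<open>b\<close>; the increments of \<open>g\<close> over these cells
    telescope.\<close>
  let ?d = "\<lambda>i. (if i \<in> {p..<q} then c else 0) + d i"
  have "c * (g b - g a) + (\<Sum>i<K. d i * (g (t (Suc i)) - g (t i)))
      = (\<Sum>i<K. ?d i * (g (t (Suc i)) - g (t i)))" for g :: "real \<Rightarrow> real"
  proof -
    have "g b - g a = (\<Sum>i\<in>{p..<q}. g (t (Suc i)) - g (t i))"
      using pq sum_Suc_diff' [of p q "\<lambda>i. g (t i)"] by simp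
    then have "c * (g b - g a) = (\<Sum>i\<in>{p..<q}. c * (g (t (Suc i)) - g (t i)))"
      by (simp add: sum_distrib_left)
    also have "\<dots> = (\<Sum>i<K. (if i \<in> {p..<q} then c else 0) * (g (t (Suc i)) - g (t i)))"
      using pq by (intro sum.mono_neutral_cong_left) auto
    finally show ?thesis by (simp add: sum.distrib [symmetric] distrib_right)
  qed
  then show ?case
    using d x by (intro exI [of _ ?d]) simp
qed

text \<open>The sorted list of \<open>F\<close> is continued constantly after its last entry,
  because \<open>standard_brownian_motion\<close> speaks of monotone sequences on all natural
  numbers; the constant tail keeps the range inside \<open>F\<close>.\<close>

lemma finite_set_partition:
  fixes F :: "real set"
  assumes "finite F" "F \<noteq> {}"
  obtains t :: "nat \<Rightarrow> real" and K where "mono t" "t ` {..K} = F" "range t = F"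
proof -
  let ?L = "sorted_list_of_set F"
  define K where "K = length ?L - 1"
  define t where "t i = ?L ! min i K" for i
  have len: "K < length ?L" using assms by (simp add: K_def card_gt_0_iff)
  have "mono t"
    unfolding t_def using len by (intro monoI sorted_nth_mono) auto
  moreover have "t ` {..K} = F"
  proof -
    have "t ` {..K} = (\<lambda>i. ?L ! i) ` {..K}" by (auto simp: t_def)
    moreover have "{..K} = {0..<length ?L}" using len by (auto simp: K_def)
    moreover have "(\<lambda>i. ?L ! i) ` {0..<length ?L} = F"
      using assms by (metis set_conv_nth nth_image take_all order_refl set_sorted_list_of_set atLeast0LessThan)
    ultimately show ?thesis by simp
  qed
  moreover have "range t = t ` {..K}"
  proof
    show "range t \<subseteq> t ` {..K}"
    proof
      fix x assume "x \<in> range t"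
      then obtain i where "x = t i" by auto
      then have "x = t (min i K)" by (simp add: t_def)
      then show "x \<in> t ` {..K}" by auto
    qed
  qed auto
  ultimately show ?thesis using that by auto
qed

lemma indicator_Ioc_eq: "a \<le> b \<Longrightarrow> indicator {a<..b} x = (indicator {..b} x - indicator {..a} x :: real)"
  for a b x :: real
  by (auto simp: indicator_def)

text \<open>Half-open cells of a monotone sequence are pairwise disjoint, so all cross terms of the
  square vanish.\<close>

lemma square_sum_disjoint_Ioc:
  fixes t d :: "nat \<Rightarrow> real"
  assumes "mono t"
  shows "(\<Sum>i<K. d i * indicator {t i<..t (Suc i)} x)\<^sup>2 = (\<Sum>i<K. (d i)\<^sup>2 * indicator {t i<..t (Suc i)} x)"
proof -
  have disj: "indicator {t i<..t (Suc i)} x * indicator {t j<..t (Suc j)} x = (0::real)" if "i \<noteq> j" for i j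
  proof -
    have *: "indicator {t i<..t (Suc i)} x * indicator {t j<..t (Suc j)} x = (0::real)" if "i < j" for i j
      using monoD [OF assms, of "Suc i" j] that by (auto simp: indicator_def)
    show ?thesis
      using * [of i j] * [of j i] that by (metis mult.commute nat_neq_iff)
  qed
  have "(\<Sum>i<K. d i * indicator {t i<..t (Suc i)} x) * (\<Sum>i<K. d i * indicator {t i<..t (Suc i)} x) =
      (\<Sum>i<K. \<Sum>j<K. if i = j then (d i)\<^sup>2 * indicator {t i<..t (Suc i)} x else 0)"
    unfolding sum_product
  proof (intro sum.cong refl)
    fix i j
    show "d i * indicator {t i<..t (Suc i)} x * (d j * indicator {t j<..t (Suc j)} x) =
       (if i = j then (d i)\<^sup>2 * indicator {t i<..t (Suc i)} x else 0)"
      using disj [of i j] by (cases "i = j") (auto simp: indicator_def power2_eq_square)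
  qed
  then show ?thesis by (simp add: power2_eq_square [of "sum _ _"])
qed

text \<open>The intervals in the list may overlap. Rewritten over the partition by all end points,
  the integral becomes a sum of independent increments, and the square of the step function
  integrates cell by cell to the variance of that sum.\<close>

lemma (in prob_space) nn_integral_exp_step_integral_brownian:
  assumes w: "standard_brownian_motion M w"
    and xs: "\<forall>(a, b, c)\<in>set xs. 0 \<le> a \<and> a \<le> b \<and> b \<le> T"
  shows "(\<integral>\<^sup>+\<omega>. ennreal (exp (step_integral w xs \<omega>)) \<partial>M)
    = ennreal (exp ((LINT s:{0..T}|lebesgue. (step_fun xs s)\<^sup>2) / 2))"
proof (cases "xs = []")
  case True
  then show ?thesis by (simp add: step_integral_def step_fun_def emeasure_space_1)
next
  case False
  define F where "F = fst ` set xs \<union> (fst \<circ> snd) ` set xs"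
  have "finite F" "F \<noteq> {}" using False by (auto simp: F_def)
  then obtain t :: "nat \<Rightarrow> real" and K where t: "mono t" "t ` {..K} = F" "range t = F"
    by (rule finite_set_partition)
  have tF: "t i \<in> F" for i using t by auto
  have F: "0 \<le> s \<and> s \<le> T" if "s \<in> F" for s
    using that xs by (force simp: F_def)
  have t0: "0 \<le> t i" "t i \<le> T" for i using tF F by auto
  have mono_Suc: "t i \<le> t (Suc i)" for i by (rule monoD [OF t(1)]) simp
  have "\<forall>(a, b, c)\<in>set xs. a \<le> b \<and> a \<in> t ` {..K} \<and> b \<in> t ` {..K}"
    unfolding t(2) using xs by (force simp: F_def)
  from step_common_partition [OF t(1) this]
  obtain d where d: "\<And>g::real \<Rightarrow> real.
      (\<Sum>(a, b, c)\<leftarrow>xs. c * (g b - g a)) = (\<Sum>i<K. d i * (g (t (Suc i)) - g (t i)))"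
    by blast
  have I: "step_integral w xs \<omega> = (\<Sum>i<K. d i * (w (t (Suc i)) \<omega> - w (t i) \<omega>))" for \<omega>
    unfolding step_integral_def by (rule d [of "\<lambda>s. w s \<omega>"])
  have f: "step_fun xs s = (\<Sum>i<K. d i * indicator {t i<..t (Suc i)} s)" for s
  proof -
    have "step_fun xs s = (\<Sum>(a, b, c)\<leftarrow>xs. c * (indicator {..b} s - indicator {..a} s))"
      unfolding step_fun_def using xs
      by (intro arg_cong [of _ _ sum_list] map_cong) (auto simp: indicator_Ioc_eq)
    also have "\<dots> = (\<Sum>i<K. d i * (indicator {..t (Suc i)} s - indicator {..t i} s))"
      by (rule d [of "\<lambda>b. indicator {..b} s"])
    finally show ?thesis by (simp add: indicator_Ioc_eq mono_Suc)
  qed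
  have "(LINT s:{0..T}|lebesgue. (step_fun xs s)\<^sup>2) = (LINT s|lebesgue. (step_fun xs s)\<^sup>2)"
    unfolding set_lebesgue_integral_def
  proof (rule Bochner_Integration.integral_cong)
    fix s
    have "step_fun xs s = 0" if "s \<notin> {0..T}"
      unfolding f using t0(1) t0(2) that
      by (intro sum.neutral) (auto simp: indicator_def intro: order_trans less_imp_le le_less_trans)
    then show "indicat_real {0..T} s *\<^sub>R (step_fun xs s)\<^sup>2 = (step_fun xs s)\<^sup>2"
      by (auto simp: indicator_def)
  qed simp
  also have "\<dots> = (\<Sum>i<K. (d i)\<^sup>2 * (t (Suc i) - t i))"
    unfolding f square_sum_disjoint_Ioc [OF t(1)]
    by (subst Bochner_Integration.integral_sum) (auto simp: mono_Suc)
  finally show ?thesis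
    unfolding I using nn_integral_exp_brownian_increments [OF w t0(1) t(1)] by simp
qed

section \<open>Square integrable functions and mean-square limits\<close>

definition sq_integrable :: "'b measure \<Rightarrow> ('b \<Rightarrow> real) \<Rightarrow> bool" where
  "sq_integrable N f \<longleftrightarrow> f \<in> borel_measurable N \<and> integrable N (\<lambda>x. (f x)\<^sup>2)"

lemma sq_integrable_measurable [measurable_dest]: "sq_integrable N f \<Longrightarrow> f \<in> borel_measurable N"
  by (simp add: sq_integrable_def)

lemma sq_integrable_mult:
  assumes [measurable]: "sq_integrable N f" "sq_integrable N g"
  shows "integrable N (\<lambda>x. f x * g x)"
proof (rule Bochner_Integration.integrable_bound)
  show "integrable N (\<lambda>x. (f x)\<^sup>2 + (g x)\<^sup>2)"
    using assms by (auto simp: sq_integrable_def)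
  have "\<bar>a * b\<bar> \<le> a\<^sup>2 + b\<^sup>2" for a b :: real
  proof -
    have "0 \<le> (\<bar>a\<bar> - \<bar>b\<bar>)\<^sup>2" by simp
    then have "2 * \<bar>a * b\<bar> \<le> a\<^sup>2 + b\<^sup>2" by (simp add: power2_diff abs_mult)
    then show ?thesis by linarith
  qed
  then show "AE x in N. norm (f x * g x) \<le> norm ((f x)\<^sup>2 + (g x)\<^sup>2)" by simp
qed measurable

lemma sq_integrable_affine:
  assumes [measurable]: "sq_integrable N f" "sq_integrable N g"
  shows "sq_integrable N (\<lambda>x. a * f x + g x)"
proof -
  have "integrable N (\<lambda>x. a\<^sup>2 * (f x)\<^sup>2 + (g x)\<^sup>2 + 2 * a * (f x * g x))"
    using assms sq_integrable_mult [OF assms] by (auto simp: sq_integrable_def)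
  then show ?thesis
    unfolding sq_integrable_def by (auto simp: power2_sum power_mult_distrib mult_ac)
qed

lemma sq_integrable_zero [simp]: "sq_integrable N (\<lambda>_. 0)"
  by (simp add: sq_integrable_def)

lemma sq_integrable_add: "sq_integrable N f \<Longrightarrow> sq_integrable N g \<Longrightarrow> sq_integrable N (\<lambda>x. f x + g x)"
  using sq_integrable_affine [of N f g 1] by simp

lemma sq_integrable_cmult: "sq_integrable N f \<Longrightarrow> sq_integrable N (\<lambda>x. a * f x)"
  using sq_integrable_affine [of N f "\<lambda>_. 0" a] by simp

lemma sq_integrable_sum:
  "(\<And>j. j \<in> A \<Longrightarrow> sq_integrable N (f j)) \<Longrightarrow> sq_integrable N (\<lambda>x. \<Sum>j\<in>A. f j x)"
  by (induction A rule: infinite_finite_induct) (auto intro: sq_integrable_add)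

text \<open>The polynomial \<open>A + 2 * t * B + t\<^sup>2 * C\<close> is the integral of the
  square of \<open>f + t * g\<close>, hence nonnegative for every \<open>t\<close>.\<close>

lemma integral_Cauchy_Schwarz:
  assumes f: "sq_integrable N f" and g: "sq_integrable N g"
  shows "(\<integral>x. f x * g x \<partial>N)\<^sup>2 \<le> (\<integral>x. (f x)\<^sup>2 \<partial>N) * (\<integral>x. (g x)\<^sup>2 \<partial>N)"
proof -
  define A B C where "A = (\<integral>x. (f x)\<^sup>2 \<partial>N)" and "B = (\<integral>x. f x * g x \<partial>N)" and "C = (\<integral>x. (g x)\<^sup>2 \<partial>N)"
  have nonneg: "0 \<le> A + 2 * t * B + t\<^sup>2 * C" for t
  proof -
    have "0 \<le> (\<integral>x. (f x + t * g x)\<^sup>2 \<partial>N)" by simp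
    also have "\<dots> = (\<integral>x. (f x)\<^sup>2 + 2 * t * (f x * g x) + t\<^sup>2 * (g x)\<^sup>2 \<partial>N)"
      by (simp add: power2_sum power_mult_distrib algebra_simps)
    also have "\<dots> = A + 2 * t * B + t\<^sup>2 * C"
      using f g sq_integrable_mult [OF f g]
      by (simp add: A_def B_def C_def sq_integrable_def)
    finally show ?thesis .
  qed
  have "C \<ge> 0" by (simp add: C_def)
  have "B\<^sup>2 \<le> A * C"
  proof (cases "C = 0")
    case True
    have "B = 0"
    proof (rule ccontr)
      assume "B \<noteq> 0"
      \<comment> \<open>With \<open>C = 0\<close> the polynomial is affine in \<open>t\<close>; this
        \<open>t\<close> is the point at which it would take the value -1.\<close>
      then have "A + 2 * (- (A + 1) / (2 * B)) * B + (- (A + 1) / (2 * B))\<^sup>2 * C = -1"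
        using True by (simp add: field_simps)
      with nonneg show False by (metis not_one_le_zero neg_0_le_iff_le)
    qed
    then show ?thesis using True by simp
  next
    case False
    with \<open>C \<ge> 0\<close> have "C > 0" by simp
    \<comment> \<open>The minimum of the polynomial, attained at \<open>t = - B / C\<close>.\<close>
    have "0 \<le> A - B\<^sup>2 / C"
      using nonneg [of "- B / C"] \<open>C > 0\<close> by (simp add: field_simps power2_eq_square)
    then show ?thesis using \<open>C > 0\<close> by (simp add: field_simps)
  qed
  then show ?thesis by (simp add: A_def B_def C_def)
qed

text \<open>Both limits are read off from the error \<open>f - h k\<close>: by Cauchy-Schwarz its
  inner product with a fixed function tends to zero, and expanding the square of \<open>f\<close>
  minus the error gives the norms. The error is known to be square integrable only for large
  \<open>k\<close>, hence the eventual statements.\<close>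

lemma L2_convergence:
  fixes h :: "nat \<Rightarrow> 'b \<Rightarrow> real"
  assumes f: "sq_integrable N f" and h [measurable]: "\<And>k. h k \<in> borel_measurable N"
    and lim: "(\<lambda>k. \<integral>\<^sup>+x. ennreal ((f x - h k x)\<^sup>2) \<partial>N) \<longlonglongrightarrow> 0"
  shows "\<And>g. sq_integrable N g \<Longrightarrow> (\<lambda>k. \<integral>x. h k x * g x \<partial>N) \<longlonglongrightarrow> (\<integral>x. f x * g x \<partial>N)"
    and "(\<lambda>k. \<integral>x. (h k x)\<^sup>2 \<partial>N) \<longlonglongrightarrow> (\<integral>x. (f x)\<^sup>2 \<partial>N)"
proof -
  let ?e = "\<lambda>k x. f x - h k x"
  have [measurable]: "f \<in> borel_measurable N" using f by (simp add: sq_integrable_def)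
  have ev: "\<forall>\<^sub>F k in sequentially. (\<integral>\<^sup>+x. ennreal ((?e k x)\<^sup>2) \<partial>N) < 1"
    using order_tendstoD(2) [OF lim, of 1] by simp
  have ev_sq: "\<forall>\<^sub>F k in sequentially. sq_integrable N (?e k)"
    using ev
  proof eventually_elim
    case (elim k)
    then have "(\<integral>\<^sup>+x. ennreal ((?e k x)\<^sup>2) \<partial>N) < \<infinity>"
      by (metis ennreal_one_less_top infinity_ennreal_def less_trans)
    then show ?case
      unfolding sq_integrable_def by (auto intro!: integrableI_bounded)
  qed
  \<comment> \<open>The passage to Bochner integrals is valid for every \<open>k\<close>: where the
    nonnegative integral is infinite, both \<open>enn2real\<close> and the Bochner integral are
    0.\<close>
  have "(\<lambda>k. enn2real (\<integral>\<^sup>+x. ennreal ((?e k x)\<^sup>2) \<partial>N)) \<longlonglongrightarrow> 0"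
    using lim by (intro tendsto_enn2real) auto
  then have lim0: "(\<lambda>k. \<integral>x. (?e k x)\<^sup>2 \<partial>N) \<longlonglongrightarrow> 0"
    by (simp add: integral_eq_nn_integral)
  have inner0: "(\<lambda>k. \<integral>x. ?e k x * g x \<partial>N) \<longlonglongrightarrow> 0" if g: "sq_integrable N g" for g
  proof -
    have "(\<lambda>k. (\<integral>x. ?e k x * g x \<partial>N)\<^sup>2) \<longlonglongrightarrow> 0"
    proof (rule tendsto_sandwich [where f = "\<lambda>_. 0"])
      show "\<forall>\<^sub>F k in sequentially. (\<integral>x. ?e k x * g x \<partial>N)\<^sup>2 \<le> (\<integral>x. (?e k x)\<^sup>2 \<partial>N) * (\<integral>x. (g x)\<^sup>2 \<partial>N)"
        using ev_sq by eventually_elim (rule integral_Cauchy_Schwarz [OF _ g])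
      show "(\<lambda>k. (\<integral>x. (?e k x)\<^sup>2 \<partial>N) * (\<integral>x. (g x)\<^sup>2 \<partial>N)) \<longlonglongrightarrow> 0"
        using tendsto_mult [OF lim0 tendsto_const] by simp
    qed auto
    then have "(\<lambda>k. sqrt ((\<integral>x. ?e k x * g x \<partial>N)\<^sup>2)) \<longlonglongrightarrow> sqrt 0"
      by (rule tendsto_real_sqrt)
    then show ?thesis by (simp add: tendsto_rabs_zero_iff)
  qed
  show "(\<lambda>k. \<integral>x. h k x * g x \<partial>N) \<longlonglongrightarrow> (\<integral>x. f x * g x \<partial>N)" if g: "sq_integrable N g" for g
  proof (rule Lim_transform_eventually)
    show "(\<lambda>k. (\<integral>x. f x * g x \<partial>N) - (\<integral>x. ?e k x * g x \<partial>N)) \<longlonglongrightarrow> (\<integral>x. f x * g x \<partial>N)"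
      using tendsto_diff [OF tendsto_const inner0 [OF g]] by simp
    show "\<forall>\<^sub>F k in sequentially. (\<integral>x. f x * g x \<partial>N) - (\<integral>x. ?e k x * g x \<partial>N) = (\<integral>x. h k x * g x \<partial>N)"
      using ev_sq
    proof eventually_elim
      case (elim k)
      have "(\<integral>x. f x * g x \<partial>N) - (\<integral>x. ?e k x * g x \<partial>N) = (\<integral>x. f x * g x - ?e k x * g x \<partial>N)"
        by (intro Bochner_Integration.integral_diff [symmetric] sq_integrable_mult f g elim)
      then show ?case by (simp add: algebra_simps)
    qed
  qed
  show "(\<lambda>k. \<integral>x. (h k x)\<^sup>2 \<partial>N) \<longlonglongrightarrow> (\<integral>x. (f x)\<^sup>2 \<partial>N)"
  proof (rule Lim_transform_eventually)
    show "(\<lambda>k. (\<integral>x. (f x)\<^sup>2 \<partial>N) - 2 * (\<integral>x. ?e k x * f x \<partial>N) + (\<integral>x. (?e k x)\<^sup>2 \<partial>N)) \<longlonglongrightarrow> (\<integral>x. (f x)\<^sup>2 \<partial>N)"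
      using tendsto_add [OF tendsto_diff [OF tendsto_const tendsto_mult [OF tendsto_const inner0 [OF f]]] lim0]
      by simp
    show "\<forall>\<^sub>F k in sequentially. (\<integral>x. (f x)\<^sup>2 \<partial>N) - 2 * (\<integral>x. ?e k x * f x \<partial>N) + (\<integral>x. (?e k x)\<^sup>2 \<partial>N)
        = (\<integral>x. (h k x)\<^sup>2 \<partial>N)"
      using ev_sq
    proof eventually_elim
      case (elim k)
      have "(\<integral>x. (f x)\<^sup>2 \<partial>N) - 2 * (\<integral>x. ?e k x * f x \<partial>N) + (\<integral>x. (?e k x)\<^sup>2 \<partial>N)
         = (\<integral>x. (f x)\<^sup>2 - 2 * (?e k x * f x) + (?e k x)\<^sup>2 \<partial>N)"
        using f elim sq_integrable_mult [OF elim f] by (simp add: sq_integrable_def)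
      also have "\<dots> = (\<integral>x. (h k x)\<^sup>2 \<partial>N)"
        by (intro Bochner_Integration.integral_cong) (auto simp: power2_eq_square algebra_simps)
      finally show ?case .
    qed
  qed
qed

section \<open>Lebesgue measure on an interval, and step integrals of the observed process\<close>

text \<open>As a finite measure in its own right, the restriction admits the general results on
  \<open>sq_integrable\<close>, and square integrability over it implies integrability.\<close>

abbreviation leb :: "real \<Rightarrow> real measure" where
  "leb T \<equiv> restrict_space lebesgue {0..T}"

lemma finite_measure_leb: "finite_measure (leb T)"
proof (intro finite_measureI)
  show "emeasure (leb T) (space (leb T)) \<noteq> \<infinity>"
    by (cases "0 \<le> T") (simp_all add: space_restrict_space emeasure_restrict_space)
qed

lemma nn_integral_leb: "(\<integral>\<^sup>+t\<in>{0..T}. f t \<partial>lebesgue) = (\<integral>\<^sup>+t. f t \<partial>leb T)"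
  by (simp add: nn_integral_restrict_space)

lemma set_lebesgue_integral_leb: "(LINT t:{0..T}|lebesgue. f t) = (LINT t|leb T. f t)"
  for f :: "real \<Rightarrow> real"
  by (simp add: integral_restrict_space set_lebesgue_integral_def)

lemma set_integrable_leb: "set_integrable lebesgue {0..T} f \<longleftrightarrow> integrable (leb T) f"
  for f :: "real \<Rightarrow> real"
  by (simp add: integrable_restrict_space set_integrable_def)

lemma measurable_leb: "f \<in> borel_measurable lebesgue \<Longrightarrow> f \<in> borel_measurable (leb T)"
  by (rule measurable_restrict_space1)

lemma sq_integrable_leb_integrable: "sq_integrable (leb T) f \<Longrightarrow> integrable (leb T) f"
  unfolding sq_integrable_def
  using finite_measure.square_integrable_imp_integrable [OF finite_measure_leb] by blast

lemma step_fun_measurable [measurable]: "step_fun xs \<in> borel_measurable lebesgue"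
proof (induction xs)
  case (Cons x xs)
  obtain a b c where "x = (a, b, c)" by (cases x) auto
  then have "step_fun (x # xs) = (\<lambda>t. c * indicator {a<..b} t + step_fun xs t)"
    by (simp add: step_fun_def fun_eq_iff)
  moreover have "indicat_real {a<..b} \<in> borel_measurable lebesgue"
    by (rule borel_measurable_indicator) simp
  ultimately show ?case using Cons
    by (simp del: borel_measurable_indicator_iff)
qed (simp add: step_fun_def [abs_def])

lemma step_integral_measurable:
  assumes "\<And>t. t \<in> {0..T} \<Longrightarrow> y t \<in> borel_measurable M"
    and "\<forall>(a, b, c)\<in>set xs. 0 \<le> a \<and> a \<le> b \<and> b \<le> T"
  shows "step_integral y xs \<in> borel_measurable M"
  using assms(2)
proof (induction xs)
  case (Cons x xs)
  obtain a b c where x: "x = (a, b, c)" by (cases x) auto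
  then have [measurable]: "y a \<in> borel_measurable M" "y b \<in> borel_measurable M"
    using Cons.prems assms(1) by auto
  have "step_integral y (x # xs) = (\<lambda>\<omega>. c * (y b \<omega> - y a \<omega>) + step_integral y xs \<omega>)"
    using x by (simp add: step_integral_def fun_eq_iff)
  then show ?case using Cons by simp
qed (simp add: step_integral_def [abs_def])

text \<open>A statement about one path: the initial value \<open>y 0 \<omega>\<close> cancels in
  every increment, which leaves the drift over \<open>(a, b]\<close> and the increment of
  \<open>w\<close>. Integrability is part of the conclusion because the induction has to add the
  drift integrals.\<close>

lemma step_integral_signal:
  assumes S: "integrable (leb T) S"
    and y: "\<forall>t\<in>{0..T}. y t \<omega> = y 0 \<omega> + (LINT s:{0..t}|lebesgue. S s) + w t \<omega>"
    and xs: "\<forall>(a, b, c)\<in>set xs. 0 \<le> a \<and> a \<le> b \<and> b \<le> T"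
  shows "integrable (leb T) (\<lambda>s. step_fun xs s * S s) \<and>
    step_integral y xs \<omega> = (LINT s|leb T. step_fun xs s * S s) + step_integral w xs \<omega>"
  using xs
proof (induction xs)
  case Nil
  show ?case by (simp add: step_fun_def step_integral_def)
next
  case (Cons x xs)
  obtain a b c where x: "x = (a, b, c)" by (cases x) auto
  have abT: "0 \<le> a" "a \<le> b" "b \<le> T" using Cons.prems x by auto
  have S': "set_integrable lebesgue {0..T} S" using S by (simp add: set_integrable_leb)
  have int0: "set_integrable lebesgue {0..T} (\<lambda>s. indicator {a<..b} s * S s)"
  proof -
    have "set_integrable lebesgue {a<..b} S"
      using abT by (intro set_integrable_subset [OF S']) auto
    moreover have "indicator {0..T} s *\<^sub>R (indicator {a<..b} s * S s) = indicator {a<..b} s *\<^sub>R S s" for s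
      using abT by (auto simp: indicator_def)
    ultimately show ?thesis unfolding set_integrable_def by presburger
  qed
  then have int: "integrable (leb T) (\<lambda>s. c * (indicator {a<..b} s * S s))"
    by (simp add: set_integrable_leb)
  have "(LINT s:{0..b}|lebesgue. S s) = (LINT s:{0..a}|lebesgue. S s) + (LINT s:{a<..b}|lebesgue. S s)"
  proof -
    have un: "{0..b} = {0..a} \<union> {a<..b}" using abT by auto
    show ?thesis
      unfolding un using abT by (intro set_integral_Un set_integrable_subset [OF S']) auto
  qed
  moreover have "(LINT s:{a<..b}|lebesgue. S s) = (LINT s|leb T. indicator {a<..b} s * S s)"
    unfolding set_lebesgue_integral_leb [symmetric] set_lebesgue_integral_def
    using abT by (intro Bochner_Integration.integral_cong) (auto simp: indicator_def)
  moreover have "y b \<omega> = y 0 \<omega> + (LINT s:{0..b}|lebesgue. S s) + w b \<omega>"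
    "y a \<omega> = y 0 \<omega> + (LINT s:{0..a}|lebesgue. S s) + w a \<omega>"
    using abT by (intro bspec [OF y]; simp)+
  ultimately have inc: "y b \<omega> - y a \<omega> = (LINT s|leb T. indicator {a<..b} s * S s) + (w b \<omega> - w a \<omega>)"
    by linarith
  have IH: "integrable (leb T) (\<lambda>s. step_fun xs s * S s)"
    "step_integral y xs \<omega> = (LINT s|leb T. step_fun xs s * S s) + step_integral w xs \<omega>"
    using Cons by auto
  have f: "step_fun (x # xs) s * S s = c * (indicator {a<..b} s * S s) + step_fun xs s * S s" for s
    by (simp add: step_fun_def x algebra_simps)
  have "step_integral y (x # xs) \<omega> = c * (y b \<omega> - y a \<omega>) + step_integral y xs \<omega>"
    by (simp add: step_integral_def x)
  moreover have "step_integral w (x # xs) \<omega> = c * (w b \<omega> - w a \<omega>) + step_integral w xs \<omega>"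
    by (simp add: step_integral_def x)
  ultimately show ?case
    unfolding f using int IH by (simp add: inc algebra_simps)
qed

section \<open>Linearity and exponential moments of the stochastic integral\<close>

text \<open>The approximating list is the scaled list for \<open>f\<close> followed by the list for
  \<open>g\<close>; both \<open>step_fun\<close> and \<open>step_integral\<close> are linear under
  these operations.\<close>

lemma has_stochastic_integral_affine:
  assumes I: "has_stochastic_integral M y T f I" and J: "has_stochastic_integral M y T g J"
    and meas: "f \<in> borel_measurable lebesgue" "g \<in> borel_measurable lebesgue"
    and y: "\<And>t. t \<in> {0..T} \<Longrightarrow> y t \<in> borel_measurable M"
  shows "has_stochastic_integral M y T (\<lambda>t. r * f t + g t) (\<lambda>\<omega>. r * I \<omega> + J \<omega>)"
proof -
  from I obtain xs where xs: "\<And>k. \<forall>(a, b, c)\<in>set (xs k). 0 \<le> a \<and> a \<le> b \<and> b \<le> T"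
    "(\<lambda>k. \<integral>\<^sup>+t. ennreal ((f t - step_fun (xs k) t)\<^sup>2) \<partial>leb T) \<longlonglongrightarrow> 0"
    "(\<lambda>k. \<integral>\<^sup>+\<omega>. ennreal ((I \<omega> - step_integral y (xs k) \<omega>)\<^sup>2) \<partial>M) \<longlonglongrightarrow> 0"
    and [measurable]: "I \<in> borel_measurable M"
    unfolding has_stochastic_integral_def nn_integral_leb by blast
  from J obtain zs where zs: "\<And>k. \<forall>(a, b, c)\<in>set (zs k). 0 \<le> a \<and> a \<le> b \<and> b \<le> T"
    "(\<lambda>k. \<integral>\<^sup>+t. ennreal ((g t - step_fun (zs k) t)\<^sup>2) \<partial>leb T) \<longlonglongrightarrow> 0"
    "(\<lambda>k. \<integral>\<^sup>+\<omega>. ennreal ((J \<omega> - step_integral y (zs k) \<omega>)\<^sup>2) \<partial>M) \<longlonglongrightarrow> 0"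
    and [measurable]: "J \<in> borel_measurable M"
    unfolding has_stochastic_integral_def nn_integral_leb by blast
  define us where "us k = map (\<lambda>(a, b, c). (a, b, r * c)) (xs k) @ zs k" for k
  have scale_fun: "step_fun (map (\<lambda>(a, b, c). (a, b, r * c)) l) t = r * step_fun l t" for l t
    unfolding step_fun_def by (induction l) (auto simp: algebra_simps)
  have scale_int: "step_integral y (map (\<lambda>(a, b, c). (a, b, r * c)) l) t = r * step_integral y l t" for l t
    unfolding step_integral_def by (induction l) (auto simp: algebra_simps)
  have us_fun: "step_fun (us k) t = r * step_fun (xs k) t + step_fun (zs k) t" for k t
    unfolding us_def scale_fun [symmetric] by (simp add: step_fun_def)
  have us_int: "step_integral y (us k) t = r * step_integral y (xs k) t + step_integral y (zs k) t" for k t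
    unfolding us_def scale_int [symmetric] by (simp add: step_integral_def)
  \<comment> \<open>One estimate, based on
    \<open>(p + q)\<^sup>2 \<le> 2 * p\<^sup>2 + 2 * q\<^sup>2\<close>, serves for the convergence
    in time over \<open>leb T\<close> and for the convergence over \<open>M\<close>.\<close>
  have comb: "(\<lambda>k. \<integral>\<^sup>+x. ennreal ((r * F x + G x - (r * F' k x + G' k x))\<^sup>2) \<partial>N) \<longlonglongrightarrow> 0"
    if lim: "(\<lambda>k. \<integral>\<^sup>+x. ennreal ((F x - F' k x)\<^sup>2) \<partial>N) \<longlonglongrightarrow> 0"
      "(\<lambda>k. \<integral>\<^sup>+x. ennreal ((G x - G' k x)\<^sup>2) \<partial>N) \<longlonglongrightarrow> 0"
      and [measurable]: "F \<in> borel_measurable N" "G \<in> borel_measurable N"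
      "\<And>k. F' k \<in> borel_measurable N" "\<And>k. G' k \<in> borel_measurable N"
    for F G :: "'c \<Rightarrow> real" and F' G' :: "nat \<Rightarrow> 'c \<Rightarrow> real" and N
  proof (rule tendsto_sandwich [where f = "\<lambda>_. 0"])
    let ?B = "\<lambda>k. ennreal (2 * r\<^sup>2) * (\<integral>\<^sup>+x. ennreal ((F x - F' k x)\<^sup>2) \<partial>N)
         + 2 * (\<integral>\<^sup>+x. ennreal ((G x - G' k x)\<^sup>2) \<partial>N)"
    have pt: "(r * a + b - (r * a' + b'))\<^sup>2 \<le> 2 * r\<^sup>2 * (a - a')\<^sup>2 + 2 * (b - b')\<^sup>2" for a b a' b' :: real
    proof -
      have "0 \<le> (r * (a - a') - (b - b'))\<^sup>2" by simp
      then show ?thesis by (simp add: power2_eq_square algebra_simps)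
    qed
    have "(\<integral>\<^sup>+x. ennreal ((r * F x + G x - (r * F' k x + G' k x))\<^sup>2) \<partial>N)
        \<le> (\<integral>\<^sup>+x. ennreal (2 * r\<^sup>2) * ennreal ((F x - F' k x)\<^sup>2) + 2 * ennreal ((G x - G' k x)\<^sup>2) \<partial>N)" for k
    proof (rule nn_integral_mono)
      fix x
      have "ennreal (2 * r\<^sup>2) * ennreal ((F x - F' k x)\<^sup>2) + 2 * ennreal ((G x - G' k x)\<^sup>2)
          = ennreal (2 * r\<^sup>2 * (F x - F' k x)\<^sup>2 + 2 * (G x - G' k x)\<^sup>2)"
        by (simp add: ennreal_mult)
      then show "ennreal ((r * F x + G x - (r * F' k x + G' k x))\<^sup>2)
          \<le> ennreal (2 * r\<^sup>2) * ennreal ((F x - F' k x)\<^sup>2) + 2 * ennreal ((G x - G' k x)\<^sup>2)"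
        using pt by (metis ennreal_leI)
    qed
    also have "\<dots> k = ?B k" for k
      by (simp add: nn_integral_add nn_integral_cmult)
    finally show "\<forall>\<^sub>F k in sequentially. (\<integral>\<^sup>+x. ennreal ((r * F x + G x - (r * F' k x + G' k x))\<^sup>2) \<partial>N) \<le> ?B k"
      by simp
    have "?B \<longlonglongrightarrow> ennreal (2 * r\<^sup>2) * 0 + 2 * 0"
      by (intro tendsto_add ennreal_tendsto_cmult lim) auto
    then show "?B \<longlonglongrightarrow> 0" by simp
  qed auto
  have "(\<lambda>k. \<integral>\<^sup>+t. ennreal ((r * f t + g t - step_fun (us k) t)\<^sup>2) \<partial>leb T) \<longlonglongrightarrow> 0"
    unfolding us_fun using meas
    by (intro comb xs zs measurable_leb step_fun_measurable)
  moreover have "(\<lambda>k. \<integral>\<^sup>+\<omega>. ennreal ((r * I \<omega> + J \<omega> - step_integral y (us k) \<omega>)\<^sup>2) \<partial>M) \<longlonglongrightarrow> 0"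
    unfolding us_int
    by (intro comb xs(3) zs(3) step_integral_measurable [OF y xs(1)] step_integral_measurable [OF y zs(1)]) auto
  moreover have "\<forall>k. \<forall>(a, b, c)\<in>set (us k). 0 \<le> a \<and> a \<le> b \<and> b \<le> T"
  proof
    fix k
    show "\<forall>(a, b, c)\<in>set (us k). 0 \<le> a \<and> a \<le> b \<and> b \<le> T"
      using xs(1) [of k] zs(1) [of k] unfolding us_def by (auto simp: ball_Un)
  qed
  ultimately show ?thesis
    unfolding has_stochastic_integral_def nn_integral_leb by (intro conjI exI [of _ us]) measurable
qed

lemma has_stochastic_integral_lin_comb:
  assumes "finite A" "\<And>j. j \<in> A \<Longrightarrow> has_stochastic_integral M y T (\<phi> j) (J j)"
    and "\<And>j. j \<in> A \<Longrightarrow> \<phi> j \<in> borel_measurable lebesgue"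
    and y: "\<And>t. t \<in> {0..T} \<Longrightarrow> y t \<in> borel_measurable M"
  shows "has_stochastic_integral M y T (lin_comb \<phi> A u) (\<lambda>\<omega>. \<Sum>j\<in>A. u j * J j \<omega>)"
  using assms(1-3)
proof (induction A rule: finite_induct)
  case empty
  show ?case
    unfolding has_stochastic_integral_def lin_comb_def
    by (auto intro!: exI [of _ "\<lambda>_. []"] simp: step_fun_def step_integral_def)
next
  case (insert a A)
  have "lin_comb \<phi> A u \<in> borel_measurable lebesgue"
    unfolding lin_comb_def [abs_def] using insert.prems by auto
  then have "has_stochastic_integral M y T (\<lambda>t. u a * \<phi> a t + lin_comb \<phi> A u t)
      (\<lambda>\<omega>. u a * J a \<omega> + (\<Sum>j\<in>A. u j * J j \<omega>))"
    using insert y by (intro has_stochastic_integral_affine) auto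
  then show ?case
    using insert.hyps by (simp add: lin_comb_def [abs_def])
qed

text \<open>Only the inequality is needed below, so Fatou's lemma along an almost surely convergent
  subsequence suffices.\<close>

lemma (in prob_space) nn_integral_exp_stochastic_integral:
  assumes w: "standard_brownian_motion M w" and y: "signal_in_noise M T S w y"
    and S: "sq_integrable (leb T) S" and f: "sq_integrable (leb T) f"
    and I: "has_stochastic_integral M y T f I"
  shows "(\<integral>\<^sup>+\<omega>. ennreal (exp (I \<omega> - (LINT s|leb T. f s * S s))) \<partial>M)
    \<le> ennreal (exp ((LINT s|leb T. (f s)\<^sup>2) / 2))"
proof -
  from I obtain xs where xs: "\<And>k. \<forall>(a, b, c)\<in>set (xs k). 0 \<le> a \<and> a \<le> b \<and> b \<le> T"
    "(\<lambda>k. \<integral>\<^sup>+t. ennreal ((f t - step_fun (xs k) t)\<^sup>2) \<partial>leb T) \<longlonglongrightarrow> 0"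
    "(\<lambda>k. \<integral>\<^sup>+\<omega>. ennreal ((I \<omega> - step_integral y (xs k) \<omega>)\<^sup>2) \<partial>M) \<longlonglongrightarrow> 0"
    and Im [measurable]: "I \<in> borel_measurable M"
    unfolding has_stochastic_integral_def nn_integral_leb by blast
  have [measurable]: "step_integral y (xs k) \<in> borel_measurable M" for k
    using y by (intro step_integral_measurable [OF _ xs(1)]) (auto simp: signal_in_noise_def)
  have [measurable]: "step_integral w (xs k) \<in> borel_measurable M" for k
    using w by (intro step_integral_measurable [OF _ xs(1)]) (auto simp: standard_brownian_motion_def)
  note cf = L2_convergence [OF f _ xs(2), OF measurable_leb [OF step_fun_measurable]]
  let ?D = "\<lambda>k \<omega>. I \<omega> - step_integral y (xs k) \<omega>"
  have "\<forall>\<^sub>F k in sequentially. (\<integral>\<^sup>+\<omega>. ennreal ((?D k \<omega>)\<^sup>2) \<partial>M) < 1"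
    using order_tendstoD(2) [OF xs(3), of 1] by simp
  \<comment> \<open>From \<open>k0\<close> on the mean-square error is finite, so the shifted
    squared errors are integrable and converge to zero in the mean.\<close>
  then obtain k0 where k0: "\<And>k. k \<ge> k0 \<Longrightarrow> (\<integral>\<^sup>+\<omega>. ennreal ((?D k \<omega>)\<^sup>2) \<partial>M) < 1"
    by (auto simp: eventually_sequentially)
  have "integrable M (\<lambda>\<omega>. (?D (k + k0) \<omega>)\<^sup>2)" for k
  proof (rule integrableI_bounded)
    show "(\<integral>\<^sup>+\<omega>. ennreal (norm ((?D (k + k0) \<omega>)\<^sup>2)) \<partial>M) < \<infinity>"
      using k0 [of "k + k0"] by simp (metis ennreal_one_less_top less_trans)
  qed measurable
  moreover have "(\<lambda>k. \<integral>\<omega>. norm ((?D (k + k0) \<omega>)\<^sup>2) \<partial>M) \<longlonglongrightarrow> 0"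
  proof -
    have "(\<lambda>k. enn2real (\<integral>\<^sup>+\<omega>. ennreal ((?D k \<omega>)\<^sup>2) \<partial>M)) \<longlonglongrightarrow> 0"
      using xs(3) by (intro tendsto_enn2real) auto
    from LIMSEQ_ignore_initial_segment [OF this, of k0] show ?thesis
      by (simp add: integral_eq_nn_integral)
  qed
  ultimately obtain r where r: "strict_mono r" "AE \<omega> in M. (\<lambda>k. (?D (r k + k0) \<omega>)\<^sup>2) \<longlonglongrightarrow> 0"
    using tendsto_L1_AE_subseq [of M "\<lambda>k \<omega>. (?D (k + k0) \<omega>)\<^sup>2"] by auto
  define q where "q k = r k + k0" for k
  have q: "filterlim q at_top sequentially"
    unfolding q_def using filterlim_subseq [OF r(1)]
    by (auto intro!: filterlim_at_top_mono [of r])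
  let ?c = "LINT s|leb T. f s * S s" and ?h = "\<lambda>k. step_fun (xs k)"
  have AE_y: "AE \<omega> in M. \<forall>t\<in>{0..T}. y t \<omega> = y 0 \<omega> + (LINT s:{0..t}|lebesgue. S s) + w t \<omega>"
    using y by (simp add: signal_in_noise_def)
  \<comment> \<open>Along \<open>q\<close> the errors vanish almost surely, and the drift integrals
    converge to \<open>?c\<close>. Hence \<open>I \<omega> - ?c\<close> is the limit of step
    integrals of \<open>w\<close>; its exponential is written as a lower limit to suit Fatou's
    lemma.\<close>
  have "AE \<omega> in M. ennreal (exp (I \<omega> - ?c)) = liminf (\<lambda>k. ennreal (exp (step_integral w (xs (q k)) \<omega>)))"
    using AE_y r(2)
  proof eventually_elim
    case (elim \<omega>)
    have "(\<lambda>k. sqrt ((?D (q k) \<omega>)\<^sup>2)) \<longlonglongrightarrow> sqrt 0"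
      using elim(2) unfolding q_def by (rule tendsto_real_sqrt)
    then have "(\<lambda>k. ?D (q k) \<omega>) \<longlonglongrightarrow> 0" by (simp add: tendsto_rabs_zero_iff)
    then have "(\<lambda>k. I \<omega> - ?D (q k) \<omega>) \<longlonglongrightarrow> I \<omega> - 0" by (intro tendsto_intros)
    moreover have "(\<lambda>k. LINT s|leb T. ?h (q k) s * S s) \<longlonglongrightarrow> ?c"
      using filterlim_compose [OF cf(1) [OF S] q] .
    ultimately have "(\<lambda>k. I \<omega> - ?D (q k) \<omega> - (LINT s|leb T. ?h (q k) s * S s)) \<longlonglongrightarrow> I \<omega> - 0 - ?c"
      by (rule tendsto_diff)
    moreover have "I \<omega> - ?D (q k) \<omega> - (LINT s|leb T. ?h (q k) s * S s) = step_integral w (xs (q k)) \<omega>" for k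
      using step_integral_signal [where y = y and w = w, OF sq_integrable_leb_integrable [OF S] elim(1) xs(1) [of "q k"]]
      by linarith
    ultimately have "(\<lambda>k. step_integral w (xs (q k)) \<omega>) \<longlonglongrightarrow> I \<omega> - ?c" by simp
    then have "(\<lambda>k. ennreal (exp (step_integral w (xs (q k)) \<omega>))) \<longlonglongrightarrow> ennreal (exp (I \<omega> - ?c))"
      by (intro tendsto_ennrealI tendsto_exp)
    then show ?case by (intro lim_imp_Liminf [symmetric]) auto
  qed
  then have "(\<integral>\<^sup>+\<omega>. ennreal (exp (I \<omega> - ?c)) \<partial>M)
      = (\<integral>\<^sup>+\<omega>. liminf (\<lambda>k. ennreal (exp (step_integral w (xs (q k)) \<omega>))) \<partial>M)"
    by (rule nn_integral_cong_AE)
  also have "\<dots> \<le> liminf (\<lambda>k. \<integral>\<^sup>+\<omega>. ennreal (exp (step_integral w (xs (q k)) \<omega>)) \<partial>M)"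
    by (rule nn_integral_liminf) simp
  \<comment> \<open>For step functions the moment is known exactly, and their squared norms converge
    to that of \<open>f\<close>, so the lower limit is a limit.\<close>
  also have "\<dots> = liminf (\<lambda>k. ennreal (exp ((LINT s|leb T. (?h (q k) s)\<^sup>2) / 2)))"
    by (simp add: nn_integral_exp_step_integral_brownian [OF w xs(1)] set_lebesgue_integral_leb)
  also have "\<dots> = ennreal (exp ((LINT s|leb T. (f s)\<^sup>2) / 2))"
  proof (rule lim_imp_Liminf)
    show "(\<lambda>k. ennreal (exp ((LINT s|leb T. (?h (q k) s)\<^sup>2) / 2)))
        \<longlonglongrightarrow> ennreal (exp ((LINT s|leb T. (f s)\<^sup>2) / 2))"
      by (intro tendsto_ennrealI tendsto_exp tendsto_divide filterlim_compose [OF cf(2) q] tendsto_const) simp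
  qed simp
  finally show ?thesis .
qed

section \<open>Periodic functions and orthonormal systems\<close>

text \<open>Induction on the number of periods: translation carries the last period to
  \<open>{0..1}\<close>, and neighbouring intervals share only a null set.\<close>

lemma integral_leb_periodic:
  fixes g :: "real \<Rightarrow> real"
  assumes per: "\<And>t. g (t + 1) = g t" and g: "integrable (leb 1) g"
  shows "integrable (leb (real n)) g \<and> (LINT t|leb (real n). g t) = real n * (LINT t|leb 1. g t)"
  unfolding set_integrable_leb [symmetric] set_lebesgue_integral_leb [symmetric]
proof (induction n)
  case 0
  have "AE t in lebesgue. t \<noteq> (0::real)" by (intro AE_completion AE_lborel_singleton)
  then have ae: "AE t in lebesgue. indicator {0..0} t *\<^sub>R g t = 0"
    by eventually_elim (simp add: indicator_def)
  have eq: "(\<lambda>t. indicator {0..0} t *\<^sub>R g t) = (\<lambda>t. g 0 * indicator {0} t)"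
    by (auto simp: indicator_def)
  have "set_integrable lebesgue {0..0} g"
    unfolding set_integrable_def eq by simp
  moreover have "(LINT t:{0..0}|lebesgue. g t) = 0"
    unfolding set_lebesgue_integral_def using ae by (rule integral_eq_zero_AE)
  ultimately show ?case by simp
next
  case (Suc n)
  have per_n: "g (real n + t) = g t" for t
  proof (induction n arbitrary: t)
    case (Suc n)
    show ?case using per [of "real n + t"] Suc by (simp add: add_ac)
  qed simp
  have shift: "(\<lambda>t. indicator {real n..real (Suc n)} (real n + 1 * t) *\<^sub>R g (real n + 1 * t))
      = (\<lambda>t. indicator {0..1} t *\<^sub>R g t)"
    by (auto simp: per_n indicator_def)
  have g01: "set_integrable lebesgue {0..1} g" using g by (simp add: set_integrable_leb)
  have i1: "set_integrable lebesgue {real n..real (Suc n)} g"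
    using lebesgue_integrable_real_affine_iff [of 1 "\<lambda>t. indicator {real n..real (Suc n)} t *\<^sub>R g t" "real n"] g01
    unfolding set_integrable_def shift by simp
  have e1: "(LINT t:{real n..real (Suc n)}|lebesgue. g t) = (LINT t:{0..1}|lebesgue. g t)"
    using lebesgue_integral_real_affine [of 1 "\<lambda>t. indicator {real n..real (Suc n)} t *\<^sub>R g t" "real n"]
    unfolding set_lebesgue_integral_def shift by simp
  have un: "{0..real (Suc n)} = {0..real n} \<union> {real n..real (Suc n)}" by auto
  have "AE t in lebesgue. t \<noteq> real n" by (intro AE_completion AE_lborel_singleton)
  then have "AE t in lebesgue. \<not> (t \<in> {0..real n} \<and> t \<in> {real n..real (Suc n)})"
    by eventually_elim auto
  then have "(LINT t:{0..real (Suc n)}|lebesgue. g t) =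
      (LINT t:{0..real n}|lebesgue. g t) + (LINT t:{real n..real (Suc n)}|lebesgue. g t)"
    unfolding un using Suc i1 by (intro set_integral_Un_AE) auto
  moreover have "set_integrable lebesgue {0..real (Suc n)} g"
    unfolding un using Suc i1 by (intro set_integrable_Un) auto
  ultimately show ?case using Suc e1 by (simp add: algebra_simps)
qed

lemma ip_leb: "ip x y = (LINT t|leb 1. x t * y t)"
  by (simp add: ip_def set_lebesgue_integral_leb)

lemma periodic_L2_sq_integrable:
  assumes "x \<in> periodic_L2"
  shows "sq_integrable (leb (real n)) x"
proof -
  have "integrable (leb 1) (\<lambda>t. (x t)\<^sup>2)"
    using assms by (simp add: periodic_L2_def set_integrable_leb)
  then have "integrable (leb (real n)) (\<lambda>t. (x t)\<^sup>2)"
    using assms by (intro conjunct1 [OF integral_leb_periodic]) (auto simp: periodic_L2_def)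
  then show ?thesis
    using assms by (auto simp: sq_integrable_def periodic_L2_def intro: measurable_leb)
qed

lemma periodic_L2_sq_integrable_1: "x \<in> periodic_L2 \<Longrightarrow> sq_integrable (leb 1) x"
  using periodic_L2_sq_integrable [of x 1] by simp

lemma integral_leb_periodic_L2:
  assumes "x \<in> periodic_L2" "y \<in> periodic_L2"
  shows "(LINT t|leb (real n). x t * y t) = real n * ip x y"
  unfolding ip_leb
  using assms
  by (intro conjunct2 [OF integral_leb_periodic] sq_integrable_mult periodic_L2_sq_integrable_1)
    (auto simp: periodic_L2_def)

lemma integral_lin_comb:
  assumes "\<And>j. j \<in> A \<Longrightarrow> sq_integrable N (\<phi> j)" "sq_integrable N g"
  shows "(\<integral>t. lin_comb \<phi> A u t * g t \<partial>N) = (\<Sum>j\<in>A. u j * (\<integral>t. \<phi> j t * g t \<partial>N))"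
proof -
  have "(\<integral>t. lin_comb \<phi> A u t * g t \<partial>N) = (\<integral>t. (\<Sum>j\<in>A. u j * (\<phi> j t * g t)) \<partial>N)"
    by (simp add: lin_comb_def sum_distrib_right mult.assoc)
  also have "\<dots> = (\<Sum>j\<in>A. \<integral>t. u j * (\<phi> j t * g t) \<partial>N)"
    using assms by (intro Bochner_Integration.integral_sum integrable_mult_right sq_integrable_mult)
  finally show ?thesis by simp
qed

lemma sq_integrable_lin_comb:
  "(\<And>j. j \<in> A \<Longrightarrow> sq_integrable N (\<phi> j)) \<Longrightarrow> sq_integrable N (lin_comb \<phi> A u)"
  unfolding lin_comb_def [abs_def] by (intro sq_integrable_sum sq_integrable_cmult)

text \<open>Over \<open>n\<close> periods the functions stay orthogonal and have squared norm
  \<open>n\<close>. The case \<open>n = 1\<close> gives the norm in the function space, the general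
  case the variance of the noise.\<close>

lemma integral_leb_lin_comb:
  assumes "orthonormal_system \<phi>" "finite A" "A \<subseteq> {1..}"
  shows "(LINT t|leb (real n). (lin_comb \<phi> A u t)\<^sup>2) = real n * (\<Sum>j\<in>A. (u j)\<^sup>2)"
proof -
  have \<phi>: "\<phi> j \<in> periodic_L2" "sq_integrable (leb (real n)) (\<phi> j)" if "j \<in> A" for j
    using assms that by (auto simp: orthonormal_system_def intro: periodic_L2_sq_integrable)
  have "(LINT t|leb (real n). \<phi> i t * lin_comb \<phi> A u t) = real n * u i" if i: "i \<in> A" for i
  proof -
    have "(LINT t|leb (real n). lin_comb \<phi> A u t * \<phi> i t)
        = (\<Sum>j\<in>A. u j * (LINT t|leb (real n). \<phi> j t * \<phi> i t))"
      using i \<phi> by (intro integral_lin_comb)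
    also have "\<dots> = (\<Sum>j\<in>A. u j * (real n * (if j = i then 1 else 0)))"
      using assms i \<phi> by (intro sum.cong) (auto simp: integral_leb_periodic_L2 orthonormal_system_def subset_iff)
    also have "\<dots> = (\<Sum>j\<in>A. if j = i then real n * u j else 0)"
      by (intro sum.cong) auto
    finally show ?thesis using assms i by (simp add: mult.commute)
  qed
  moreover have "(LINT t|leb (real n). lin_comb \<phi> A u t * lin_comb \<phi> A u t)
      = (\<Sum>i\<in>A. u i * (LINT t|leb (real n). \<phi> i t * lin_comb \<phi> A u t))"
    using \<phi> by (intro integral_lin_comb sq_integrable_lin_comb)
  ultimately show ?thesis
    by (simp add: power2_eq_square sum_distrib_left mult_ac)
qed

lemma sqnorm_lin_comb:
  assumes "orthonormal_system \<phi>" "finite A" "A \<subseteq> {1..}"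
  shows "sqnorm (lin_comb \<phi> A u) = (\<Sum>j\<in>A. (u j)\<^sup>2)"
  using integral_leb_lin_comb [OF assms, of 1] by (simp add: sqnorm_def ip_leb power2_eq_square)

text \<open>Expresses the loss as a polynomial in the coefficients, so that measurability and
  integrability in \<open>\<omega>\<close> can be read off when only the coefficients are
  random.\<close>

lemma sqnorm_lin_comb_diff:
  assumes "orthonormal_system \<phi>" "finite A" "A \<subseteq> {1..}" "S \<in> periodic_L2"
  shows "sqnorm (\<lambda>t. lin_comb \<phi> A u t - S t)
    = (\<Sum>j\<in>A. (u j)\<^sup>2) - 2 * (\<Sum>j\<in>A. u j * ip (\<phi> j) S) + sqnorm S"
proof -
  have \<phi>: "sq_integrable (leb 1) (\<phi> j)" if "j \<in> A" for j
    using assms that by (auto simp: orthonormal_system_def intro: periodic_L2_sq_integrable_1)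
  have S: "sq_integrable (leb 1) S" using assms by (simp add: periodic_L2_sq_integrable_1)
  have u: "sq_integrable (leb 1) (lin_comb \<phi> A u)" using \<phi> by (rule sq_integrable_lin_comb)
  have "sqnorm (\<lambda>t. lin_comb \<phi> A u t - S t)
      = (LINT t|leb 1. lin_comb \<phi> A u t * lin_comb \<phi> A u t - 2 * (lin_comb \<phi> A u t * S t) + S t * S t)"
    by (simp add: sqnorm_def ip_leb algebra_simps)
  also have "\<dots> = sqnorm (lin_comb \<phi> A u) - 2 * (LINT t|leb 1. lin_comb \<phi> A u t * S t) + sqnorm S"
    using sq_integrable_mult [OF u u] sq_integrable_mult [OF u S] sq_integrable_mult [OF S S]
    by (simp add: sqnorm_def ip_leb)
  finally show ?thesis
    using assms by (simp add: sqnorm_lin_comb integral_lin_comb [OF \<phi> S] ip_leb)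
qed

text \<open>The squared distance of \<open>S\<close> from its orthogonal projection on the span is
  nonnegative.\<close>

lemma Bessel_inequality:
  assumes "orthonormal_system \<phi>" "finite A" "A \<subseteq> {1..}" "S \<in> periodic_L2"
  shows "(\<Sum>j\<in>A. (ip (\<phi> j) S)\<^sup>2) \<le> sqnorm S"
proof -
  have "0 \<le> sqnorm (\<lambda>t. lin_comb \<phi> A (\<lambda>j. ip (\<phi> j) S) t - S t)"
    unfolding sqnorm_def ip_leb by (intro Bochner_Integration.integral_nonneg) simp
  then show ?thesis
    unfolding sqnorm_lin_comb_diff [OF assms] by (simp add: power2_eq_square)
qed

section \<open>Exponential moments of the noise coordinates\<close>

text \<open>By linearity the sum is the centred stochastic integral of the single function
  \<open>lin_comb \<phi> A u\<close>, whose squared norm over \<open>n\<close> periods is explicit.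
  Having the bound for all \<open>u\<close> controls the coordinates jointly.\<close>

lemma (in prob_space) nn_integral_exp_noise:
  assumes w: "standard_brownian_motion M w" and y: "signal_in_noise M (real n) S w y"
    and S: "S \<in> periodic_L2" and \<phi>: "orthonormal_system \<phi>"
    and J: "\<And>j. j \<ge> 1 \<Longrightarrow> has_stochastic_integral M y (real n) (\<phi> j) (J j)"
    and A: "finite A" "A \<subseteq> {1..}"
  shows "(\<integral>\<^sup>+\<omega>. ennreal (exp (\<Sum>j\<in>A. u j * (J j \<omega> - real n * ip (\<phi> j) S))) \<partial>M)
    \<le> ennreal (exp (real n * (\<Sum>j\<in>A. (u j)\<^sup>2) / 2))"
proof -
  have \<phi>j: "\<phi> j \<in> periodic_L2" "sq_integrable (leb (real n)) (\<phi> j)" if "j \<in> A" for j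
    using \<phi> A that by (auto simp: orthonormal_system_def intro: periodic_L2_sq_integrable)
  have Sn: "sq_integrable (leb (real n)) S" using S by (rule periodic_L2_sq_integrable)
  have I: "has_stochastic_integral M y (real n) (lin_comb \<phi> A u) (\<lambda>\<omega>. \<Sum>j\<in>A. u j * J j \<omega>)"
    using A J \<phi>j y
    by (intro has_stochastic_integral_lin_comb) (auto simp: signal_in_noise_def periodic_L2_def)
  have "(LINT s|leb (real n). lin_comb \<phi> A u s * S s) = (\<Sum>j\<in>A. u j * (LINT s|leb (real n). \<phi> j s * S s))"
    using \<phi>j Sn by (intro integral_lin_comb)
  also have "\<dots> = (\<Sum>j\<in>A. u j * (real n * ip (\<phi> j) S))"
    by (intro sum.cong refl) (simp add: integral_leb_periodic_L2 \<phi>j S)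
  finally show ?thesis
    using nn_integral_exp_stochastic_integral [OF w y Sn sq_integrable_lin_comb [OF \<phi>j(2)] I]
    by (simp add: integral_leb_lin_comb [OF \<phi> A] right_diff_distrib sum_subtractf)
qed

text \<open>Integrating the exponential bound against independent standard normal \<open>u j / sqrt 2\<close>,
  one coordinate at a time, turns linear exponents into quadratic ones.\<close>

lemma (in prob_space) nn_integral_exp_sum_squares:
  assumes A: "finite A" and Z [measurable]: "\<And>j. j \<in> A \<Longrightarrow> Z j \<in> borel_measurable M"
    and sub: "\<And>u. (\<integral>\<^sup>+\<omega>. ennreal (exp (\<Sum>j\<in>A. u j * Z j \<omega>)) \<partial>M) \<le> ennreal (exp ((\<Sum>j\<in>A. (u j)\<^sup>2) / 2))"
  shows "(\<integral>\<^sup>+\<omega>. ennreal (exp ((\<Sum>j\<in>A. (Z j \<omega>)\<^sup>2) / 4)) \<partial>M) \<le> ennreal (sqrt 2 ^ card A)"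
proof -
  interpret L: pair_sigma_finite M lborel
    by (rule pair_sigma_finite.intro) unfold_locales
  \<comment> \<open>The induction set \<open>B\<close> holds the coordinates already turned into
    squares, while those in \<open>A - B\<close> still enter linearly with arbitrary
    \<open>u\<close>.\<close>
  have "(\<integral>\<^sup>+\<omega>. ennreal (exp ((\<Sum>j\<in>B. (Z j \<omega>)\<^sup>2) / 4 + (\<Sum>j\<in>A - B. u j * Z j \<omega>))) \<partial>M)
      \<le> ennreal (sqrt 2 ^ card B * exp ((\<Sum>j\<in>A - B. (u j)\<^sup>2) / 2))" if "finite B" "B \<subseteq> A" for B u
    using that
  proof (induction B arbitrary: u rule: finite_induct)
    case empty
    then show ?case using sub by simp
  next
    case (insert a B)
    have a: "a \<in> A" "a \<notin> B" and B: "B \<subseteq> A" using insert by auto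
    have [measurable]: "Z a \<in> borel_measurable M" using a Z by blast
    let ?C = "A - insert a B"
    define W where "W \<omega> = (\<Sum>j\<in>B. (Z j \<omega>)\<^sup>2) / 4 + (\<Sum>j\<in>?C. u j * Z j \<omega>)" for \<omega>
    have [measurable]: "W \<in> borel_measurable M"
      unfolding W_def [abs_def]
      by (intro borel_measurable_add borel_measurable_divide borel_measurable_sum
          borel_measurable_power borel_measurable_times borel_measurable_const Z) (use B in auto)
    have AB: "A - B = insert a ?C" "a \<notin> ?C" "finite ?C" using a A by auto
    have step: "(\<integral>\<^sup>+\<omega>. ennreal (exp (W \<omega> + x / sqrt 2 * Z a \<omega>)) \<partial>M)
        \<le> ennreal (sqrt 2 ^ card B * exp ((\<Sum>j\<in>?C. (u j)\<^sup>2) / 2)) * ennreal (exp (x\<^sup>2 / 4))" for x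
    proof -
      \<comment> \<open>Coordinate \<open>a\<close> receives the weight \<open>x / sqrt 2\<close>,
        half of whose square is the exponent \<open>x\<^sup>2 / 4\<close>.\<close>
      define u' where "u' = u(a := x / sqrt 2)"
      have "(\<Sum>j\<in>A - B. u' j * Z j \<omega>) = x / sqrt 2 * Z a \<omega> + (\<Sum>j\<in>?C. u j * Z j \<omega>)" for \<omega>
        unfolding AB(1) sum.insert [OF AB(3,2)] u'_def
        by (intro arg_cong2 [of _ _ _ _ "(+)"] sum.cong) auto
      then have 1: "W \<omega> + x / sqrt 2 * Z a \<omega> = (\<Sum>j\<in>B. (Z j \<omega>)\<^sup>2) / 4 + (\<Sum>j\<in>A - B. u' j * Z j \<omega>)" for \<omega>
        by (simp add: W_def)
      have "(\<Sum>j\<in>A - B. (u' j)\<^sup>2) = x\<^sup>2 / 2 + (\<Sum>j\<in>?C. (u j)\<^sup>2)"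
        unfolding AB(1) sum.insert [OF AB(3,2)] u'_def
        by (intro arg_cong2 [of _ _ _ _ "(+)"] sum.cong) (auto simp: power_divide)
      then have 2: "sqrt 2 ^ card B * exp ((\<Sum>j\<in>A - B. (u' j)\<^sup>2) / 2)
          = sqrt 2 ^ card B * exp ((\<Sum>j\<in>?C. (u j)\<^sup>2) / 2) * exp (x\<^sup>2 / 4)"
        by (simp add: add_divide_distrib exp_add)
      show ?thesis
        using insert.IH [OF B, of u'] unfolding 1 2 by (simp add: ennreal_mult)
    qed
    \<comment> \<open>For fixed \<open>\<omega>\<close>, averaging
      \<open>exp (x / sqrt 2 * Z a \<omega>)\<close> over a standard normal \<open>x\<close> gives
      \<open>exp ((Z a \<omega>)\<^sup>2 / 4)\<close>.\<close>
    have "(\<integral>\<^sup>+\<omega>. ennreal (exp ((\<Sum>j\<in>insert a B. (Z j \<omega>)\<^sup>2) / 4 + (\<Sum>j\<in>?C. u j * Z j \<omega>))) \<partial>M)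
        = (\<integral>\<^sup>+\<omega>. \<integral>\<^sup>+x. ennreal (std_normal_density x) * ennreal (exp (W \<omega> + x / sqrt 2 * Z a \<omega>)) \<partial>lborel \<partial>M)"
    proof (rule nn_integral_cong)
      fix \<omega>
      have "(\<integral>\<^sup>+x. ennreal (std_normal_density x) * ennreal (exp (W \<omega> + x / sqrt 2 * Z a \<omega>)) \<partial>lborel)
          = (\<integral>\<^sup>+x. ennreal (exp (W \<omega>)) * (ennreal (std_normal_density x) * ennreal (exp (Z a \<omega> / sqrt 2 * x))) \<partial>lborel)"
        by (intro nn_integral_cong) (simp add: exp_add ennreal_mult mult_ac)
      also have "\<dots> = ennreal (exp (W \<omega>)) * ennreal (exp ((Z a \<omega>)\<^sup>2 / 4))"
        using nn_integral_exp_normal_density [of 1 "Z a \<omega> / sqrt 2"]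
        by (subst nn_integral_cmult) (simp_all add: power_divide)
      also have "\<dots> = ennreal (exp ((\<Sum>j\<in>insert a B. (Z j \<omega>)\<^sup>2) / 4 + (\<Sum>j\<in>?C. u j * Z j \<omega>)))"
        using insert.hyps by (simp add: W_def ennreal_mult' [symmetric] exp_add [symmetric] add_divide_distrib add_ac)
      finally show "ennreal (exp ((\<Sum>j\<in>insert a B. (Z j \<omega>)\<^sup>2) / 4 + (\<Sum>j\<in>?C. u j * Z j \<omega>)))
          = (\<integral>\<^sup>+x. ennreal (std_normal_density x) * ennreal (exp (W \<omega> + x / sqrt 2 * Z a \<omega>)) \<partial>lborel)"
        by simp
    qed
    \<comment> \<open>With the order exchanged, the induction hypothesis applies for each
      \<open>x\<close>, and the remaining Gaussian integral contributes one factor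
      \<open>sqrt 2\<close> per coordinate.\<close>
    also have "\<dots> = (\<integral>\<^sup>+x. \<integral>\<^sup>+\<omega>. ennreal (std_normal_density x) * ennreal (exp (W \<omega> + x / sqrt 2 * Z a \<omega>)) \<partial>M \<partial>lborel)"
      by (rule L.Fubini' [symmetric]) measurable
    also have "\<dots> = (\<integral>\<^sup>+x. ennreal (std_normal_density x) * (\<integral>\<^sup>+\<omega>. ennreal (exp (W \<omega> + x / sqrt 2 * Z a \<omega>)) \<partial>M) \<partial>lborel)"
      by (simp add: nn_integral_cmult)
    also have "\<dots> \<le> (\<integral>\<^sup>+x. ennreal (std_normal_density x) *
        (ennreal (sqrt 2 ^ card B * exp ((\<Sum>j\<in>?C. (u j)\<^sup>2) / 2)) * ennreal (exp (x\<^sup>2 / 4))) \<partial>lborel)"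
      by (intro nn_integral_mono mult_left_mono step) simp
    also have "\<dots> = (\<integral>\<^sup>+x. ennreal (sqrt 2 ^ card B * exp ((\<Sum>j\<in>?C. (u j)\<^sup>2) / 2)) *
        (ennreal (std_normal_density x) * ennreal (exp (x\<^sup>2 / 4))) \<partial>lborel)"
      by (simp add: mult_ac)
    also have "\<dots> = ennreal (sqrt 2 ^ card B * exp ((\<Sum>j\<in>?C. (u j)\<^sup>2) / 2)) * ennreal (sqrt 2)"
      by (simp add: nn_integral_cmult nn_integral_exp_square_std_normal)
    also have "\<dots> = ennreal (sqrt 2 ^ card (insert a B) * exp ((\<Sum>j\<in>?C. (u j)\<^sup>2) / 2))"
      using insert.hyps by (simp add: ennreal_mult' [symmetric] mult_ac)
    finally show ?case .
  qed
  from this [OF A subset_refl, of "\<lambda>_. 0"] show ?thesis by simp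
qed

text \<open>From \<open>1 + x / 4 \<le> exp (x / 4)\<close> the second moment is at most
  \<open>4 * sqrt 2 - 4\<close>, and \<open>sqrt 2 \<le> 3 / 2\<close>.\<close>

lemma (in prob_space) expectation_square_le:
  assumes [measurable]: "Z \<in> borel_measurable M"
    and bound: "(\<integral>\<^sup>+\<omega>. ennreal (exp ((Z \<omega>)\<^sup>2 / 4)) \<partial>M) \<le> ennreal (sqrt 2)"
  shows "integrable M (\<lambda>\<omega>. (Z \<omega>)\<^sup>2)" "expectation (\<lambda>\<omega>. (Z \<omega>)\<^sup>2) \<le> 2"
proof -
  have int: "integrable M (\<lambda>\<omega>. exp ((Z \<omega>)\<^sup>2 / 4))"
    using bound by (intro integrableI_bounded) (auto simp: le_less_trans)
  have E: "expectation (\<lambda>\<omega>. exp ((Z \<omega>)\<^sup>2 / 4)) \<le> sqrt 2"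
    using bound by (simp add: nn_integral_eq_integral [OF int])
  have pt: "(Z \<omega>)\<^sup>2 \<le> 4 * exp ((Z \<omega>)\<^sup>2 / 4) - 4" for \<omega>
    using exp_ge_add_one_self [of "(Z \<omega>)\<^sup>2 / 4"] by linarith
  show sq: "integrable M (\<lambda>\<omega>. (Z \<omega>)\<^sup>2)"
  proof (rule Bochner_Integration.integrable_bound)
    show "integrable M (\<lambda>\<omega>. 4 * exp ((Z \<omega>)\<^sup>2 / 4) - 4)" using int by simp
    show "AE \<omega> in M. norm ((Z \<omega>)\<^sup>2) \<le> norm (4 * exp ((Z \<omega>)\<^sup>2 / 4) - 4)"
      using pt by (auto intro: order_trans [OF _ abs_ge_self])
  qed measurable
  have "expectation (\<lambda>\<omega>. (Z \<omega>)\<^sup>2) \<le> expectation (\<lambda>\<omega>. 4 * exp ((Z \<omega>)\<^sup>2 / 4) - 4)"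
    using sq int pt by (intro integral_mono) auto
  also have "\<dots> \<le> 4 * sqrt 2 - 4"
    using int E by (simp add: prob_space)
  also have "\<dots> \<le> 2"
    using real_sqrt_le_mono [of 2 "(3/2)\<^sup>2"] by (simp add: power2_eq_square real_sqrt_divide)
  finally show "expectation (\<lambda>\<omega>. (Z \<omega>)\<^sup>2) \<le> 2" .
qed

text \<open>Subtracting \<open>8 * L * d\<close> gains \<open>exp (- 2 * L * d)\<close>. One half of
  this exponent pays for \<open>sqrt 2 ^ d\<close>, the other half is the weight summed in
  \<open>l_star\<close>.\<close>

lemma (in prob_space) expectation_exp_excess_le:
  assumes [measurable]: "X \<in> borel_measurable M" and L: "1 \<le> L"
    and bound: "(\<integral>\<^sup>+\<omega>. ennreal (exp (X \<omega> / 4)) \<partial>M) \<le> ennreal (sqrt 2 ^ d)"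
  shows "integrable M (\<lambda>\<omega>. exp ((X \<omega> - 8 * L * real d) / 4))"
    "expectation (\<lambda>\<omega>. exp ((X \<omega> - 8 * L * real d) / 4)) \<le> exp (- L * real d)"
proof -
  have int: "integrable M (\<lambda>\<omega>. exp (X \<omega> / 4))"
    using bound by (intro integrableI_bounded) (auto simp: le_less_trans)
  have E: "expectation (\<lambda>\<omega>. exp (X \<omega> / 4)) \<le> sqrt 2 ^ d"
    using bound by (simp add: nn_integral_eq_integral [OF int])
  have eq: "exp ((X \<omega> - 8 * L * real d) / 4) = exp (- 2 * L * real d) * exp (X \<omega> / 4)" for \<omega>
    by (simp add: exp_add [symmetric] field_simps)
  show "integrable M (\<lambda>\<omega>. exp ((X \<omega> - 8 * L * real d) / 4))"
    unfolding eq using int by simp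
  have "sqrt 2 ^ d \<le> exp (L * real d)"
  proof -
    have "sqrt 2 \<le> 2" using real_sqrt_le_mono [of 2 "2\<^sup>2"] by simp
    also have "\<dots> \<le> exp 1" using exp_ge_add_one_self [of 1] by simp
    also have "\<dots> \<le> exp L" using L by simp
    finally have "sqrt 2 ^ d \<le> exp L ^ d" by (intro power_mono) auto
    then show ?thesis by (simp add: exp_of_nat_mult [symmetric] mult.commute)
  qed
  with E have "expectation (\<lambda>\<omega>. exp (X \<omega> / 4)) \<le> exp (L * real d)" by simp
  then have "exp (- 2 * L * real d) * expectation (\<lambda>\<omega>. exp (X \<omega> / 4)) \<le> exp (- 2 * L * real d) * exp (L * real d)"
    by (intro mult_left_mono) auto
  also have "\<dots> = exp (- L * real d)" by (simp add: exp_add [symmetric])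
  finally show "expectation (\<lambda>\<omega>. exp ((X \<omega> - 8 * L * real d) / 4)) \<le> exp (- L * real d)"
    unfolding eq by simp
qed

section \<open>The constant \<open>z_star\<close>\<close>

text \<open>A root between 3 and 4 exists because \<open>exp 1 \<le> 3\<close> and
  \<open>ln 2 \<le> 1\<close>. To its right \<open>ln\<close> grows with slope at most 1/3, too
  slowly to meet \<open>z - 2\<close> again, so this root is the greatest one.\<close>

lemma z_star_ge_3: "3 \<le> z_star"
proof -
  have "\<exists>z\<ge>3. z \<le> 4 \<and> z - 2 - ln z = (0::real)"
  proof (rule IVT)
    have "1 \<le> ln (3::real)" using exp_le by (subst ln_ge_iff) auto
    then show "3 - 2 - ln 3 \<le> (0::real)" by simp
    have "ln (4::real) = 2 * ln 2" using ln_realpow [of "2::real" 2] by simp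
    moreover have "ln (2::real) \<le> 2 - 1" by (rule ln_le_minus_one) simp
    ultimately show "0 \<le> 4 - 2 - ln (4::real)" by simp
    show "\<forall>x::real. 3 \<le> x \<and> x \<le> 4 \<longrightarrow> isCont (\<lambda>z. z - 2 - ln z) x"
      by (auto intro!: continuous_intros)
  qed simp
  then obtain z0 :: real where z0: "3 \<le> z0" "ln z0 = z0 - 2" by auto
  have "z \<le> z0" if z: "0 < z" "ln z = z - 2" for z :: real
  proof (rule ccontr)
    assume "\<not> z \<le> z0"
    then have gt: "z0 < z" by simp
    have "ln z - ln z0 = ln (z / z0)" using z0 z by (simp add: ln_div)
    also have "\<dots> \<le> z / z0 - 1" using z0 z by (intro ln_le_minus_one) simp
    also have "\<dots> = (z - z0) / z0" using z0 by (simp add: field_simps)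
    also have "\<dots> \<le> (z - z0) / 3" using z0 gt by (intro divide_left_mono) auto
    finally show False using z z0 gt by simp
  qed
  then have "z_star = z0"
    unfolding z_star_def using z0 by (intro Greatest_equality) auto
  then show ?thesis using z0 by simp
qed

section \<open>The deterministic comparison of two losses\<close>

text \<open>In the application \<open>s\<close> holds the coefficients of the signal,
  \<open>N\<close> its squared norm, \<open>n * s j + \<xi> j\<close> is the stochastic integral of
  \<open>\<phi> j\<close>, and \<open>P\<close>, \<open>P'\<close> are the penalties. Both
  coefficient vectors are extended by zero to \<open>m \<union> m'\<close>, where they can be
  subtracted.\<close>

lemma oracle_inequality_pointwise:
  fixes c c' s \<xi> :: "nat \<Rightarrow> real" and n :: real
  assumes fin: "finite m" "finite m'" and n: "0 < n"
    and bessel: "(\<Sum>j\<in>m \<union> m'. (s j)\<^sup>2) \<le> N"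
    and le: "(\<Sum>j\<in>m'. (c' j)\<^sup>2) - 2 / n * (\<Sum>j\<in>m'. c' j * (n * s j + \<xi> j)) + P'
      \<le> (\<Sum>j\<in>m. (c j)\<^sup>2) - 2 / n * (\<Sum>j\<in>m. c j * (n * s j + \<xi> j)) + P"
  shows "(\<Sum>j\<in>m'. (c' j)\<^sup>2) - 2 * (\<Sum>j\<in>m'. c' j * s j) + N
    \<le> 3 * ((\<Sum>j\<in>m. (c j)\<^sup>2) - 2 * (\<Sum>j\<in>m. c j * s j) + N) + 2 * P - 2 * P'
      + 8 / n\<^sup>2 * ((\<Sum>j\<in>m. (\<xi> j)\<^sup>2) + (\<Sum>j\<in>m'. (\<xi> j)\<^sup>2))"
proof -
  let ?U = "m \<union> m'"
  define C where "C j = (if j \<in> m then c j else 0)" for j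
  define C' where "C' j = (if j \<in> m' then c' j else 0)" for j
  have ext: "(\<Sum>j\<in>m. g (c j) j) = (\<Sum>j\<in>?U. g (C j) j)" "(\<Sum>j\<in>m'. g (c' j) j) = (\<Sum>j\<in>?U. g (C' j) j)"
    if "\<And>j. g 0 j = 0" for g :: "real \<Rightarrow> nat \<Rightarrow> real"
    using fin that by (auto simp: C_def C'_def intro!: sum.mono_neutral_cong_left)
  define R where "R = (\<Sum>j\<in>?U. (C j)\<^sup>2) - 2 * (\<Sum>j\<in>?U. C j * s j) + N"
  define R' where "R' = (\<Sum>j\<in>?U. (C' j)\<^sup>2) - 2 * (\<Sum>j\<in>?U. C' j * s j) + N"
  define Q where "Q = (\<Sum>j\<in>m. (\<xi> j)\<^sup>2) + (\<Sum>j\<in>m'. (\<xi> j)\<^sup>2)"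
  have R_eq: "(\<Sum>j\<in>m. (c j)\<^sup>2) - 2 * (\<Sum>j\<in>m. c j * s j) + N = R"
    "(\<Sum>j\<in>m'. (c' j)\<^sup>2) - 2 * (\<Sum>j\<in>m'. c' j * s j) + N = R'"
    unfolding R_def R'_def
    using ext [of "\<lambda>x j. x\<^sup>2"] ext [of "\<lambda>x j. x * s j"] by auto
  have split: "2 / n * (\<Sum>j\<in>A. a j * (n * s j + \<xi> j)) = 2 * (\<Sum>j\<in>A. a j * s j) + 2 / n * (\<Sum>j\<in>A. a j * \<xi> j)"
    for A and a :: "nat \<Rightarrow> real"
  proof -
    have "(\<Sum>j\<in>A. a j * (n * s j + \<xi> j)) = n * (\<Sum>j\<in>A. a j * s j) + (\<Sum>j\<in>A. a j * \<xi> j)"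
      by (simp add: distrib_left sum.distrib sum_distrib_left mult_ac)
    then show ?thesis using n by (simp add: distrib_left)
  qed
  have loss_diff: "R' - R \<le> P - P' + (2 / n * (\<Sum>j\<in>m'. c' j * \<xi> j) - 2 / n * (\<Sum>j\<in>m. c j * \<xi> j))"
    using le unfolding split R_eq [symmetric] by linarith
  have "2 / n * (\<Sum>j\<in>m'. c' j * \<xi> j) - 2 / n * (\<Sum>j\<in>m. c j * \<xi> j)
      = (\<Sum>j\<in>?U. 2 / n * ((C' j - C j) * \<xi> j))"
    using ext [of "\<lambda>x j. x * \<xi> j"]
    by (simp add: sum_distrib_left left_diff_distrib sum_subtractf right_diff_distrib
        diff_divide_distrib sum_divide_distrib)
  also have "\<dots> \<le> (\<Sum>j\<in>?U. ((C' j - s j)\<^sup>2 + (C j - s j)\<^sup>2) / 2 + 4 / n\<^sup>2 * (\<xi> j)\<^sup>2)"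
  proof (rule sum_mono)
    fix j
    let ?D = "C' j - C j"
    have "(?D / 2 - 2 / n * \<xi> j)\<^sup>2 = ?D\<^sup>2 / 4 - 2 / n * (?D * \<xi> j) + 4 / n\<^sup>2 * (\<xi> j)\<^sup>2"
      using n by (simp add: power2_eq_square field_simps)
    then have "2 / n * (?D * \<xi> j) \<le> ?D\<^sup>2 / 4 + 4 / n\<^sup>2 * (\<xi> j)\<^sup>2"
      using zero_le_power2 [of "?D / 2 - 2 / n * \<xi> j"] by linarith
    \<comment> \<open>The parallelogram law bounds the square of the difference by twice the sum of
      the squared deviations from \<open>s j\<close>.\<close>
    moreover have "((C' j - s j) + (C j - s j))\<^sup>2 = 2 * ((C' j - s j)\<^sup>2 + (C j - s j)\<^sup>2) - ?D\<^sup>2"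
      by (simp add: power2_eq_square algebra_simps)
    then have "?D\<^sup>2 / 4 \<le> ((C' j - s j)\<^sup>2 + (C j - s j)\<^sup>2) / 2"
      using zero_le_power2 [of "(C' j - s j) + (C j - s j)"] by linarith
    ultimately show "2 / n * (?D * \<xi> j) \<le> ((C' j - s j)\<^sup>2 + (C j - s j)\<^sup>2) / 2 + 4 / n\<^sup>2 * (\<xi> j)\<^sup>2"
      by linarith
  qed
  also have "\<dots> = ((\<Sum>j\<in>?U. (C' j - s j)\<^sup>2) + (\<Sum>j\<in>?U. (C j - s j)\<^sup>2)) / 2 + 4 / n\<^sup>2 * (\<Sum>j\<in>?U. (\<xi> j)\<^sup>2)"
    by (simp add: sum.distrib sum_distrib_left sum_divide_distrib add_divide_distrib)
  also have "\<dots> \<le> (R' + R) / 2 + 4 / n\<^sup>2 * Q"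
  proof -
    \<comment> \<open>The slack is \<open>N\<close> minus the squares of the \<open>s j\<close>, the
      part of the signal outside the span, nonnegative by \<open>bessel\<close>.\<close>
    have sq: "(\<Sum>j\<in>?U. (a j - s j)\<^sup>2) \<le> (\<Sum>j\<in>?U. (a j)\<^sup>2) - 2 * (\<Sum>j\<in>?U. a j * s j) + N" for a
      using bessel by (simp add: power2_diff sum.distrib sum_subtractf sum_distrib_left mult.assoc)
    have "(\<Sum>j\<in>?U. (\<xi> j)\<^sup>2) \<le> Q"
      unfolding Q_def using fin sum.union_inter [of m m' "\<lambda>j. (\<xi> j)\<^sup>2"] sum_nonneg [of "m \<inter> m'" "\<lambda>j. (\<xi> j)\<^sup>2"]
      by simp
    then show ?thesis
      unfolding R_def R'_def by (intro add_mono divide_right_mono mult_left_mono sq) auto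
  qed
  finally have noise: "2 / n * (\<Sum>j\<in>m'. c' j * \<xi> j) - 2 / n * (\<Sum>j\<in>m. c j * \<xi> j)
      \<le> (R' + R) / 2 + 4 / n\<^sup>2 * Q" .
  \<comment> \<open>Half of \<open>R'\<close> moves to the left, then everything is doubled.\<close>
  have "R' \<le> 3 * R + 2 * P - 2 * P' + 2 * (4 / n\<^sup>2 * Q)"
  proof -
    have "R' \<le> 3 * R + 2 * P - 2 * P' + 2 * u" if "b \<le> (R' + R) / 2 + u" "R' - R \<le> P - P' + b" for b u
      using that by (simp add: field_simps)
    then show ?thesis using loss_diff noise by blast
  qed
  then show ?thesis unfolding R_eq Q_def by simp
qed

lemma improved_estimator_eq:
  "improved_estimator \<phi> n J v m \<omega> = lin_comb \<phi> m (improved_coeff n J v m \<omega>)"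
  by (simp add: fun_eq_iff improved_estimator_def lse_def Psi_def lin_comb_def improved_coeff_def
      distrib_right sum.distrib)

theorem theorem2:
  fixes M :: "'a measure"
    and w y :: "real \<Rightarrow> 'a \<Rightarrow> real"
    and S :: "real \<Rightarrow> real"
    and \<phi> :: "nat \<Rightarrow> real \<Rightarrow> real"
    and n :: nat
    and J :: "nat \<Rightarrow> 'a \<Rightarrow> real"
    and \<M> :: "nat set set"
    and v :: "nat set \<Rightarrow> nat \<Rightarrow> (nat \<Rightarrow> real) \<Rightarrow> real"
    and l :: "nat set \<Rightarrow> real"
    and m_star :: "'a \<Rightarrow> nat set"
  assumes "n \<ge> 1"
    and "S \<in> periodic_L2"
    and "standard_brownian_motion M w"
    and "signal_in_noise M (real n) S w y"
    and "orthonormal_system \<phi>"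
    and "\<And>j. j \<ge> 1 \<Longrightarrow> has_stochastic_integral M y (real n) (\<phi> j) (J j)"
    and "finite \<M>" and "\<M> \<noteq> {}"
    and "\<And>m. m \<in> \<M> \<Longrightarrow> finite m \<and> m \<subseteq> {1..}"
    and "\<And>m j. m \<in> \<M> \<Longrightarrow> j \<in> m \<Longrightarrow> v m j \<in> borel_measurable (\<Pi>\<^sub>M i\<in>m. borel)"
    and "\<And>m j. m \<in> \<M> \<Longrightarrow> j \<in> m \<Longrightarrow> integrable M (\<lambda>\<omega>. (v m j (alpha_vec n J m \<omega>))\<^sup>2)"
    and "\<And>m. m \<in> \<M> \<Longrightarrow> l m \<ge> 1"
    and "m_star \<in> measurable M (count_space \<M>)"
    and "\<And>\<omega>. \<omega> \<in> space M \<Longrightarrow>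
           is_arg_min (\<lambda>m. contrast \<phi> n J m (improved_coeff n J v m \<omega>) \<omega> + penalty 2 l n m)
             (\<lambda>m. m \<in> \<M>) (m_star \<omega>)"
  shows "integrable M (\<lambda>\<omega>. sqnorm (\<lambda>t. improved_estimator \<phi> n J v (m_star \<omega>) \<omega> t - S t)) \<and>
    (LINT \<omega>|M. sqnorm (\<lambda>t. improved_estimator \<phi> n J v (m_star \<omega>) \<omega> t - S t))
      \<le> (INF m\<in>\<M>. u_star M S \<phi> n J v l m) + 2 * tau0 \<M> l / real n"
proof -
  interpret prob_space M using assms(3) by (simp add: standard_brownian_motion_def)

  \<comment> \<open>Normalised noise coordinates\<close>
  note w = assms(3) and y = assms(4) and S = assms(2) and \<phi> = assms(5) and J = assms(6)
  have n: "0 < real n" using assms(1) by simp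
  have m: "finite m" "m \<subseteq> {1..}" "\<And>j. j \<in> m \<Longrightarrow> j \<ge> 1" if "m \<in> \<M>" for m
    using assms(9) [OF that] by auto
  \<comment> \<open>Division by \<open>sqrt (real n)\<close> makes the sub-Gaussian bound free of
    \<open>n\<close>.\<close>
  define Z where "Z j \<omega> = (J j \<omega> - real n * ip (\<phi> j) S) / sqrt (real n)" for j \<omega>
  have Jm [measurable]: "J j \<in> borel_measurable M" if "j \<ge> 1" for j
    using J [OF that] by (simp add: has_stochastic_integral_def)
  have Zm: "Z j \<in> borel_measurable M" if "j \<ge> 1" for j
    unfolding Z_def [abs_def] using that by measurable
  have J_Z: "J j \<omega> = sqrt (real n) * Z j \<omega> + real n * ip (\<phi> j) S" for j \<omega>
    using n by (simp add: Z_def)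
  have subgauss: "(\<integral>\<^sup>+\<omega>. ennreal (exp (\<Sum>j\<in>A. u j * Z j \<omega>)) \<partial>M) \<le> ennreal (exp ((\<Sum>j\<in>A. (u j)\<^sup>2) / 2))"
    if A: "finite A" "A \<subseteq> {1..}" for A u
  proof -
    have "(\<Sum>j\<in>A. u j / sqrt (real n) * (J j \<omega> - real n * ip (\<phi> j) S)) = (\<Sum>j\<in>A. u j * Z j \<omega>)" for \<omega>
      by (simp add: Z_def)
    moreover have "real n * (\<Sum>j\<in>A. (u j / sqrt (real n))\<^sup>2) = (\<Sum>j\<in>A. (u j)\<^sup>2)"
      using n by (simp add: power_divide sum_divide_distrib [symmetric])
    ultimately show ?thesis
      using nn_integral_exp_noise [OF w y S \<phi> J A, of "\<lambda>j. u j / sqrt (real n)"] by simp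
  qed
  have expsq: "(\<integral>\<^sup>+\<omega>. ennreal (exp ((\<Sum>j\<in>A. (Z j \<omega>)\<^sup>2) / 4)) \<partial>M) \<le> ennreal (sqrt 2 ^ card A)"
    if A: "finite A" "A \<subseteq> {1..}" for A
    using A by (intro nn_integral_exp_sum_squares subgauss Zm) auto
  have Zsq: "integrable M (\<lambda>\<omega>. (Z j \<omega>)\<^sup>2)" "expectation (\<lambda>\<omega>. (Z j \<omega>)\<^sup>2) \<le> 2" if "j \<ge> 1" for j
    using expectation_square_le [OF Zm [OF that]] expsq [of "{j}"] that by auto
  have Z_sq_int: "sq_integrable M (Z j)" if "j \<ge> 1" for j
    using Zsq Zm that by (simp add: sq_integrable_def)
  have one: "sq_integrable M (\<lambda>_. c)" for c :: real
    by (simp add: sq_integrable_def)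
  have J_sq: "sq_integrable M (J j)" if "j \<ge> 1" for j
    unfolding J_Z [abs_def] using that by (intro sq_integrable_affine Z_sq_int one)

  \<comment> \<open>Sums of squared noise coordinates and their exponential excess\<close>
  define X where "X m \<omega> = (\<Sum>j\<in>m. (Z j \<omega>)\<^sup>2)" for m \<omega>
  have X_int: "integrable M (X m)" "expectation (X m) \<le> 2 * card m" if "m \<in> \<M>" for m
  proof -
    show "integrable M (X m)"
      unfolding X_def [abs_def] using m(3) [OF that] Zsq by auto
    have "expectation (X m) = (\<Sum>j\<in>m. expectation (\<lambda>\<omega>. (Z j \<omega>)\<^sup>2))"
      unfolding X_def [abs_def] using m(3) [OF that] Zsq by (intro Bochner_Integration.integral_sum) auto
    also have "\<dots> \<le> (\<Sum>j\<in>m. 2)" using m(3) [OF that] Zsq by (intro sum_mono) auto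
    finally show "expectation (X m) \<le> 2 * card m" by simp
  qed
  define E where "E m \<omega> = exp ((X m \<omega> - 8 * l m * real (card m)) / 4)" for m \<omega>
  have E: "integrable M (E m)" "expectation (E m) \<le> exp (- l m * real (card m))" if "m \<in> \<M>" for m
    unfolding E_def [abs_def]
    using expectation_exp_excess_le [OF borel_measurable_integrable [OF X_int(1) [OF that]] assms(12) [OF that]]
      expsq [OF m(1,2) [OF that]] by (auto simp: X_def)

  \<comment> \<open>Coefficients and losses of the estimators\<close>
  define C where "C m \<omega> = improved_coeff n J v m \<omega>" for m \<omega>
  have C_sq: "sq_integrable M (\<lambda>\<omega>. C m \<omega> j)" if mM: "m \<in> \<M>" and j: "j \<in> m" for m j
  proof -
    have [measurable]: "alpha_vec n J m \<in> M \<rightarrow>\<^sub>M (\<Pi>\<^sub>M i\<in>m. borel)"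
      unfolding alpha_vec_def [abs_def] alpha_hat_def
      by (intro measurable_restrict borel_measurable_divide borel_measurable_const Jm m(3) [OF mM])
    note assms(10) [OF mM j, measurable]
    have "sq_integrable M (\<lambda>\<omega>. v m j (alpha_vec n J m \<omega>))"
      unfolding sq_integrable_def using assms(11) [OF mM j] by simp
    then show ?thesis
      using sq_integrable_affine [OF J_sq, of j "\<lambda>\<omega>. v m j (alpha_vec n J m \<omega>)" "1 / real n"] m(3) [OF mM j]
      by (simp add: C_def improved_coeff_def alpha_hat_def)
  qed
  define R where "R m \<omega> = sqnorm (\<lambda>t. improved_estimator \<phi> n J v m \<omega> t - S t)" for m \<omega>
  have R_eq: "R m \<omega> = (\<Sum>j\<in>m. (C m \<omega> j)\<^sup>2) - 2 * (\<Sum>j\<in>m. C m \<omega> j * ip (\<phi> j) S) + sqnorm S"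
    if "m \<in> \<M>" for m \<omega>
    unfolding R_def improved_estimator_eq C_def by (rule sqnorm_lin_comb_diff [OF \<phi> m(1,2) [OF that] S])
  have R_int: "integrable M (R m)" if mM: "m \<in> \<M>" for m
  proof -
    have "integrable M (\<lambda>\<omega>. (C m \<omega> j)\<^sup>2)" "integrable M (\<lambda>\<omega>. C m \<omega> j * ip (\<phi> j) S)" if "j \<in> m" for j
      using C_sq [OF mM that] sq_integrable_mult [OF C_sq [OF mM that] one] by (auto simp: sq_integrable_def)
    then show ?thesis
      unfolding R_eq [OF mM, abs_def]
      by (intro Bochner_Integration.integrable_add Bochner_Integration.integrable_diff
          Bochner_Integration.integrable_sum integrable_mult_right integrable_const)
  qed

  \<comment> \<open>Integrability of the loss at the selected index\<close>
  have star: "m_star \<omega> \<in> \<M>" if "\<omega> \<in> space M" for \<omega>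
    using assms(14) [OF that] by (simp add: is_arg_min_def)
  have R_star_int: "integrable M (\<lambda>\<omega>. R (m_star \<omega>) \<omega>)"
  proof -
    have [measurable]: "m_star -` {m} \<inter> space M \<in> sets M" if "m \<in> \<M>" for m
      using measurable_sets [OF assms(13)] that by simp
    \<comment> \<open>The loss at the random index is a finite sum of the losses \<open>R m\<close>,
      each cut down to the event that \<open>m\<close> is selected.\<close>
    have "integrable M (\<lambda>\<omega>. \<Sum>m\<in>\<M>. indicator (m_star -` {m} \<inter> space M) \<omega> *\<^sub>R R m \<omega>)"
      by (intro Bochner_Integration.integrable_sum integrable_mult_indicator R_int) auto
    moreover have "(\<Sum>m\<in>\<M>. indicator (m_star -` {m} \<inter> space M) \<omega> *\<^sub>R R m \<omega>) = R (m_star \<omega>) \<omega>"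
      if \<omega>: "\<omega> \<in> space M" for \<omega>
    proof -
      have "(\<Sum>m\<in>\<M>. indicator (m_star -` {m} \<inter> space M) \<omega> *\<^sub>R R m \<omega>)
          = (\<Sum>m\<in>\<M>. if m_star \<omega> = m then R m \<omega> else 0)"
        using \<omega> by (intro sum.cong) (auto simp: indicator_def)
      then show ?thesis using star [OF \<omega>] assms(7) by simp
    qed
    ultimately show ?thesis by (simp cong: Bochner_Integration.integrable_cong)
  qed

  \<comment> \<open>Numerical inequalities for the penalty factor\<close>
  have z: "3 \<le> z_star" by (rule z_star_ge_3)
  define a where "a = z_star\<^sup>2 / (z_star - 1)"
  have "0 \<le> (z_star - 2)\<^sup>2" by simp
  then have a4: "4 \<le> a"
    using z by (simp add: a_def field_simps power2_eq_square)
  have "0 \<le> z_star * (z_star - 3) + 1" using z by simp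
  \<comment> \<open>Twice the penalty has the factor \<open>16 * a\<close>, and \<open>8 / n\<close>
    times the bound \<open>2 * d\<close> on the noise over the fixed index accounts for the added
    16.\<close>
  then have a2: "16 * a + 16 \<le> 32 * z_star"
    using z by (simp add: a_def field_simps power2_eq_square)
  have pen: "penalty 2 l n k = 8 * a * (l k * real (card k) / real n)" for k
    by (simp add: penalty_def rho_def a_def)

  \<comment> \<open>Pointwise bound on the loss at the selected index\<close>
  have bound: "R (m_star \<omega>) \<omega> \<le> 3 * R k \<omega> + 2 * penalty 2 l n k + 8 / real n * X k \<omega> + 32 / real n * (\<Sum>m\<in>\<M>. E m \<omega>)"
    if k: "k \<in> \<M>" and \<omega>: "\<omega> \<in> space M" for k \<omega>
  proof -
    define k' where "k' = m_star \<omega>"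
    have k': "k' \<in> \<M>" using star [OF \<omega>] by (simp add: k'_def)
    define \<xi> where "\<xi> j = sqrt (real n) * Z j \<omega>" for j
    have contrast: "contrast \<phi> n J m (improved_coeff n J v m \<omega>) \<omega>
        = (\<Sum>j\<in>m. (C m \<omega> j)\<^sup>2) - 2 / real n * (\<Sum>j\<in>m. C m \<omega> j * (real n * ip (\<phi> j) S + \<xi> j))"
      if "m \<in> \<M>" for m
      unfolding contrast_def C_def sqnorm_lin_comb [OF \<phi> assms(9) [OF that, THEN conjunct1] assms(9) [OF that, THEN conjunct2]]
      by (simp add: J_Z \<xi>_def add.commute)
    have "R k' \<omega> \<le> 3 * R k \<omega> + 2 * penalty 2 l n k - 2 * penalty 2 l n k'
        + 8 / (real n)\<^sup>2 * ((\<Sum>j\<in>k. (\<xi> j)\<^sup>2) + (\<Sum>j\<in>k'. (\<xi> j)\<^sup>2))"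
      unfolding R_eq [OF k] R_eq [OF k']
    proof (rule oracle_inequality_pointwise)
      show "(\<Sum>j\<in>k \<union> k'. (ip (\<phi> j) S)\<^sup>2) \<le> sqnorm S"
        using m [OF k] m [OF k'] by (intro Bessel_inequality \<phi> S) auto
      have "\<not> contrast \<phi> n J k (improved_coeff n J v k \<omega>) \<omega> + penalty 2 l n k
          < contrast \<phi> n J k' (improved_coeff n J v k' \<omega>) \<omega> + penalty 2 l n k'"
        using assms(14) [OF \<omega>] k by (auto simp: is_arg_min_def k'_def)
      then show "(\<Sum>j\<in>k'. (C k' \<omega> j)\<^sup>2) - 2 / real n * (\<Sum>j\<in>k'. C k' \<omega> j * (real n * ip (\<phi> j) S + \<xi> j)) + penalty 2 l n k'
          \<le> (\<Sum>j\<in>k. (C k \<omega> j)\<^sup>2) - 2 / real n * (\<Sum>j\<in>k. C k \<omega> j * (real n * ip (\<phi> j) S + \<xi> j)) + penalty 2 l n k"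
        unfolding contrast [OF k] contrast [OF k'] by simp
    qed (use m [OF k] m [OF k'] n in auto)
    moreover have "(\<Sum>j\<in>A. (\<xi> j)\<^sup>2) = real n * X A \<omega>" for A
      by (simp add: \<xi>_def X_def power_mult_distrib sum_distrib_left)
    then have "8 / (real n)\<^sup>2 * ((\<Sum>j\<in>k. (\<xi> j)\<^sup>2) + (\<Sum>j\<in>k'. (\<xi> j)\<^sup>2)) = 8 / real n * X k \<omega> + 8 / real n * X k' \<omega>"
      using n by (simp add: power2_eq_square field_simps)
    \<comment> \<open>As \<open>a \<ge> 4\<close>, twice the penalty absorbs \<open>8 * ?d\<close>
      of the noise. The excess is at most \<open>4 * E k' \<omega>\<close>, and summing
      \<open>E\<close> over all of \<open>\<M>\<close> removes the dependence on the random
      index.\<close>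
    moreover have "8 / real n * X k' \<omega> - 2 * penalty 2 l n k' \<le> 32 / real n * (\<Sum>m\<in>\<M>. E m \<omega>)"
    proof -
      let ?d = "l k' * real (card k')"
      have le_4_exp: "x \<le> 4 * exp (x / 4)" for x :: real
        using exp_ge_add_one_self [of "x / 4"] by linarith
      have "0 \<le> ?d" using assms(12) [OF k'] by simp
      then have "4 * ?d \<le> a * ?d" using a4 by (rule mult_right_mono [rotated])
      moreover have "X k' \<omega> - 8 * ?d \<le> 4 * E k' \<omega>"
        using le_4_exp [of "X k' \<omega> - 8 * ?d"] by (simp add: E_def mult.assoc)
      moreover have "E k' \<omega> \<le> (\<Sum>m\<in>\<M>. E m \<omega>)"
        using k' assms(7) by (intro member_le_sum) (auto simp: E_def)
      ultimately have "X k' \<omega> - 2 * (a * ?d) \<le> 4 * (\<Sum>m\<in>\<M>. E m \<omega>)" by linarith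
      then have "8 / real n * (X k' \<omega> - 2 * (a * ?d)) \<le> 8 / real n * (4 * (\<Sum>m\<in>\<M>. E m \<omega>))"
        using n by (intro mult_left_mono) auto
      then show ?thesis by (simp add: pen right_diff_distrib diff_divide_distrib mult_ac)
    qed
    ultimately show ?thesis unfolding k'_def by linarith
  qed

  \<comment> \<open>Taking expectations and the infimum\<close>
  \<comment> \<open>The term in \<open>tau0\<close> stands on the left so that the left side is one
    lower bound for all \<open>u_star\<close>, as the infimum requires.\<close>
  have main: "expectation (\<lambda>\<omega>. R (m_star \<omega>) \<omega>) - 2 * tau0 \<M> l / real n \<le> u_star M S \<phi> n J v l k"
    if k: "k \<in> \<M>" for k
  proof -
    let ?B = "\<lambda>\<omega>. 3 * R k \<omega> + 2 * penalty 2 l n k + 8 / real n * X k \<omega> + 32 / real n * (\<Sum>m\<in>\<M>. E m \<omega>)"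
    have E_int: "integrable M (\<lambda>\<omega>. \<Sum>m\<in>\<M>. E m \<omega>)" using E by auto
    have "expectation (\<lambda>\<omega>. R (m_star \<omega>) \<omega>) \<le> expectation ?B"
      using R_int [OF k] X_int(1) [OF k] E_int bound [OF k]
      by (intro integral_mono R_star_int) auto
    also have "\<dots> = 3 * expectation (R k) + 2 * penalty 2 l n k + 8 / real n * expectation (X k)
        + 32 / real n * expectation (\<lambda>\<omega>. \<Sum>m\<in>\<M>. E m \<omega>)"
      using R_int [OF k] X_int(1) [OF k] E_int by (simp add: prob_space)
    finally have 1: "expectation (\<lambda>\<omega>. R (m_star \<omega>) \<omega>) \<le> 3 * expectation (R k) + 2 * penalty 2 l n k
        + 8 / real n * expectation (X k) + 32 / real n * expectation (\<lambda>\<omega>. \<Sum>m\<in>\<M>. E m \<omega>)" .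
    have "expectation (\<lambda>\<omega>. \<Sum>m\<in>\<M>. E m \<omega>) = (\<Sum>m\<in>\<M>. expectation (E m))"
      using E by (intro Bochner_Integration.integral_sum) auto
    also have "\<dots> \<le> l_star \<M> l" unfolding l_star_def by (intro sum_mono E)
    finally have El: "expectation (\<lambda>\<omega>. \<Sum>m\<in>\<M>. E m \<omega>) \<le> l_star \<M> l" .
    have "0 \<le> l_star \<M> l" by (simp add: l_star_def sum_nonneg)
    then have "l_star \<M> l * 1 \<le> l_star \<M> l * (z_star / (z_star - 1))"
      using z by (intro mult_left_mono) auto
    with El have "expectation (\<lambda>\<omega>. \<Sum>m\<in>\<M>. E m \<omega>) \<le> l_star \<M> l * (z_star / (z_star - 1))" by simp
    then have "32 / real n * expectation (\<lambda>\<omega>. \<Sum>m\<in>\<M>. E m \<omega>) \<le> 32 / real n * (l_star \<M> l * (z_star / (z_star - 1)))"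
      using n by (intro mult_left_mono) auto
    also have "\<dots> = 2 * tau0 \<M> l / real n" by (simp add: tau0_def)
    finally have 2: "32 / real n * expectation (\<lambda>\<omega>. \<Sum>m\<in>\<M>. E m \<omega>) \<le> 2 * tau0 \<M> l / real n" .
    let ?d = "real (card k) * l k"
    \<comment> \<open>Weights of at least 1 bound the dimension by \<open>?d\<close>, which lets the
      noise over \<open>k\<close> share the factor of the penalty.\<close>
    have "real (card k) * 1 \<le> ?d" using assms(12) [OF k] by (intro mult_left_mono) auto
    then have "expectation (X k) \<le> 2 * ?d" using X_int(2) [OF k] by simp
    moreover have "(16 * a + 16) * ?d \<le> 32 * z_star * ?d"
      using a2 assms(12) [OF k] by (intro mult_right_mono) auto
    ultimately have "16 * a * ?d + 8 * expectation (X k) \<le> 32 * z_star * ?d"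
      by (simp add: distrib_right)
    then have "(16 * a * ?d + 8 * expectation (X k)) / real n \<le> 32 * z_star * ?d / real n"
      using n by (intro divide_right_mono) auto
    then have 3: "2 * penalty 2 l n k + 8 / real n * expectation (X k) \<le> 32 * z_star * (?d / real n)"
      by (simp add: pen add_divide_distrib mult_ac)
    show ?thesis
      using 1 2 3 unfolding u_star_def R_def by linarith
  qed
  have "expectation (\<lambda>\<omega>. R (m_star \<omega>) \<omega>) - 2 * tau0 \<M> l / real n \<le> (INF m\<in>\<M>. u_star M S \<phi> n J v l m)"
    using main assms(8) by (intro cINF_greatest) auto
  then show ?thesis
    using R_star_int unfolding R_def by linarith
qed

end
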